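(* Let $\alpha>1$, $0<\beta<\infty$, $u\in H(\mathbb{D})$, $\varphi\in S(\mathbb{D})$, and suppose $uC_\varphi:\mathcal{B}^\alpha\to\mathcal{Z}_\beta$ is bounded. Then $$\|uC_\varphi\|_{e,\mathcal{B}^\alpha\to\mathcal{Z}_\beta}\asymp\max\Big\{\limsup_{n\to\infty}(n+1)^\alpha\|(2u'\varphi'+u\varphi'')\varphi^n\|_{\nu_\beta},\ \limsup_{n\to\infty}(n+1)^{\alpha+1}\|u(\varphi')^2\varphi^n\|_{\nu_\beta},\ \limsup_{n\to\infty}(n+1)^{\alpha-1}\|u''\varphi^n\|_{\nu_\beta}\Big\}.$$
   Context: $\mathbb{D}$ is the open unit disk, $H(\mathbb{D})$ the holomorphic functions on $\mathbb{D}$, $S(\mathbb{D})$ the holomorphic self-maps of $\mathbb{D}$; $uC_\varphi f(z)=u(z)f(\varphi(z))$, and $\varphi^n$ is the $n$-th power of $\varphi$. $\mathcal{B}^\alpha$ is the space of $f\in H(\mathbb{D})$ with $\sup_z(1-|z|^2)^\alpha|f'(z)|<\infty$, normed by $|f(0)|+\sup_z(1-|z|^2)^\alpha|f'(z)|$. $\mathcal{Z}_\beta$ is the space of $f\in H(\mathbb{D})$ with $\sup_z(1-|z|^2)^\beta|f''(z)|<\infty$, normed by $|f(0)|+|f'(0)|+\sup_z(1-|z|^2)^\beta|f''(z)|$. For $g\in H(\mathbb{D})$, $\|g\|_{\nu_\beta}=\sup_z(1-|z|^2)^\beta|g(z)|$. The essential norm of a bounded operator $T:X\to Y$ is $\inf\{\|T-K\|:K:X\to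 Y\text{ compact}\}$. $A\asymp B$ means $B/C\le A\le CB$ for a positive constant $C$ independent of $u,\varphi$. *)

theory Defs
  imports "HOL-Analysis.Analysis"
begin

definition disc :: "complex set" where
  "disc = ball 0 1"

definition bloch_space :: "real \<Rightarrow> (complex \<Rightarrow> complex) set" where
  "bloch_space \<alpha> = {f. f holomorphic_on disc \<and>
      bdd_above ((\<lambda>z. (1 - (cmod z)^2) powr \<alpha> * cmod (deriv f z)) ` disc)}"

definition bloch_norm :: "real \<Rightarrow> (complex \<Rightarrow> complex) \<Rightarrow> real" where
  "bloch_norm \<alpha> f = cmod (f 0) + (SUP z\<in>disc. (1 - (cmod z)^2) powr \<alpha> * cmod (deriv f z))"

definition zygmund_space :: "real \<Rightarrow> (complex \<Rightarrow> complex) set" where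
  "zygmund_space \<beta> = {f. f holomorphic_on disc \<and>
      bdd_above ((\<lambda>z. (1 - (cmod z)^2) powr \<beta> * cmod (deriv (deriv f) z)) ` disc)}"

definition zygmund_norm :: "real \<Rightarrow> (complex \<Rightarrow> complex) \<Rightarrow> real" where
  "zygmund_norm \<beta> f = cmod (f 0) + cmod (deriv f 0) +
      (SUP z\<in>disc. (1 - (cmod z)^2) powr \<beta> * cmod (deriv (deriv f) z))"

definition nu_norm :: "real \<Rightarrow> (complex \<Rightarrow> complex) \<Rightarrow> ereal" where
  "nu_norm \<beta> g = (SUP z\<in>disc. ereal ((1 - (cmod z)^2) powr \<beta> * cmod (g z)))"

definition wcomp :: "(complex \<Rightarrow> complex) \<Rightarrow> (complex \<Rightarrow> complex) \<Rightarrow>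
    (complex \<Rightarrow> complex) \<Rightarrow> (complex \<Rightarrow> complex)" where
  "wcomp u \<phi> f = (\<lambda>z. u z * f (\<phi> z))"

text \<open>Operators between spaces of holomorphic functions on the disc; functions are
  identified when they agree on the disc.\<close>
definition linear_op :: "(complex \<Rightarrow> complex) set \<Rightarrow> (complex \<Rightarrow> complex) set \<Rightarrow>
    ((complex \<Rightarrow> complex) \<Rightarrow> (complex \<Rightarrow> complex)) \<Rightarrow> bool" where
  "linear_op X Y T \<longleftrightarrow> (\<forall>f\<in>X. T f \<in> Y) \<and>
     (\<forall>f\<in>X. \<forall>g\<in>X. \<forall>a b. \<forall>z\<in>disc.
        T (\<lambda>w. a * f w + b * g w) z = a * T f z + b * T g z)"

definition bounded_op :: "(complex \<Rightarrow> complex) set \<Rightarrow> ((complex \<Rightarrow> complex) \<Rightarrow> real) \<Rightarrow>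
    (complex \<Rightarrow> complex) set \<Rightarrow> ((complex \<Rightarrow> complex) \<Rightarrow> real) \<Rightarrow>
    ((complex \<Rightarrow> complex) \<Rightarrow> (complex \<Rightarrow> complex)) \<Rightarrow> bool" where
  "bounded_op X nX Y nY T \<longleftrightarrow> linear_op X Y T \<and> (\<exists>M. \<forall>f\<in>X. nY (T f) \<le> M * nX f)"

definition compact_op :: "(complex \<Rightarrow> complex) set \<Rightarrow> ((complex \<Rightarrow> complex) \<Rightarrow> real) \<Rightarrow>
    (complex \<Rightarrow> complex) set \<Rightarrow> ((complex \<Rightarrow> complex) \<Rightarrow> real) \<Rightarrow>
    ((complex \<Rightarrow> complex) \<Rightarrow> (complex \<Rightarrow> complex)) \<Rightarrow> bool" where
  "compact_op X nX Y nY K \<longleftrightarrow> linear_op X Y K \<and>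
     (\<forall>f :: nat \<Rightarrow> complex \<Rightarrow> complex. (\<forall>n. f n \<in> X \<and> nX (f n) \<le> 1) \<longrightarrow>
        (\<exists>r g. strict_mono r \<and> g \<in> Y \<and>
           (\<lambda>n. nY (\<lambda>z. K (f (r n)) z - g z)) \<longlonglongrightarrow> 0))"

definition op_norm :: "(complex \<Rightarrow> complex) set \<Rightarrow> ((complex \<Rightarrow> complex) \<Rightarrow> real) \<Rightarrow>
    ((complex \<Rightarrow> complex) \<Rightarrow> real) \<Rightarrow>
    ((complex \<Rightarrow> complex) \<Rightarrow> (complex \<Rightarrow> complex)) \<Rightarrow> real" where
  "op_norm X nX nY T = (SUP f\<in>{f\<in>X. nX f \<le> 1}. nY (T f))"

definition essential_norm :: "(complex \<Rightarrow> complex) set \<Rightarrow> ((complex \<Rightarrow> complex) \<Rightarrow> real) \<Rightarrow>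
    (complex \<Rightarrow> complex) set \<Rightarrow> ((complex \<Rightarrow> complex) \<Rightarrow> real) \<Rightarrow>
    ((complex \<Rightarrow> complex) \<Rightarrow> (complex \<Rightarrow> complex)) \<Rightarrow> real" where
  "essential_norm X nX Y nY T =
     Inf ((\<lambda>K. op_norm X nX nY (\<lambda>f z. T f z - K f z)) ` {K. compact_op X nX Y nY K})"

end

(*
  The operator T sends f to u f(phi), whose second derivative is
  A0 f(phi) + A1 f'(phi) + A2 f''(phi) with A0 = u'', A1 = 2 u' phi' + u phi'', A2 = u phi'^2.

  Lower bound: lacunary sums of the normalised monomials c m^(alpha-1) z^m stay in the unit ball of
  the Bloch-type space, which forces K (c m^(alpha-1) z^m) to tend to 0 for every compact K.  Applying
  T - K to the monomials of degrees n, 2n, 3n and eliminating separates the contributions of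
  A0, A1 and A2.

  Upper bound: compare T with the compact operators f -> u f(r phi), r < 1.  Where |phi| is close
  to 1, Cauchy estimates for f - f(r.) meet (1 - |phi|)^(-s) <= C (n+1)^s |phi|^n for
  n = floor(1 / (2 (1 - |phi|))); elsewhere f - f(r.) is uniformly small as r tends to 1.
*)

theory Submission
  imports Defs "HOL-Complex_Analysis.Great_Picard"
begin

section \<open>Weighted spaces on the disc\<close>

text \<open>The lower bound has to hold for every compact \<open>K\<close>, and such a
  \<open>K\<close> need not respect locally uniform convergence: that the normalised monomials tend
  to 0 locally uniformly says nothing about their images. A bound on all their lacunary sums
  supplies what is missing, without duality. The exponents \<alpha>-1, \<alpha>, \<alpha>+1 are the
  boundary growth rates of f, f', f'' on the unit ball; \<alpha> > 1 makes the rate of f a power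
  instead of a logarithm or a constant. A single monomial only tests the sum of three terms, which
  may cancel. Three degrees give three equations at the same point z, so the elimination is
  pointwise; it produces |phi|^(3n), and going back to |phi|^n costs a constant. The constants may
  depend on \<alpha> only, so they are fixed before u, phi and \<open>K\<close>; the dilation radius
  and the threshold on |phi| may depend on everything. \<open>op_norm\<close> and
  \<open>essential_norm\<close> are a real supremum and infimum, informative only for bounded
  nonempty sets, while \<open>nu_norm\<close> takes extended values; finiteness of the right-hand
  side comes from the lower bound at the zero operator.\<close>

abbreviation wt :: "real \<Rightarrow> complex \<Rightarrow> real" where
  "wt s z \<equiv> (1 - (cmod z)^2) powr s"

lemma open_disc [simp]: "open disc"
  by (simp add: disc_def)

lemma in_disc: "z \<in> disc \<longleftrightarrow> cmod z < 1"
  by (simp add: disc_def dist_norm)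

lemma zero_in_disc [simp]: "0 \<in> disc"
  by (simp add: in_disc)

lemma wt_nonneg: "0 \<le> wt s z"
  by simp

lemma zygmund_holomorphic: "f \<in> zygmund_space \<beta> \<Longrightarrow> f holomorphic_on disc"
  by (simp add: zygmund_space_def)

lemma bloch_holomorphic: "f \<in> bloch_space \<alpha> \<Longrightarrow> f holomorphic_on disc"
  by (simp add: bloch_space_def)

lemma deriv_has_field_derivative:
  "f holomorphic_on disc \<Longrightarrow> z \<in> disc \<Longrightarrow> (f has_field_derivative deriv f z) (at z)"
  using holomorphic_derivI open_disc by blast

lemma deriv_holomorphic_disc: "f holomorphic_on disc \<Longrightarrow> deriv f holomorphic_on disc"
  by (simp add: holomorphic_deriv)

lemma deriv_cong_disc:
  assumes "\<And>z. z \<in> disc \<Longrightarrow> f z = g z" "z \<in> disc"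
  shows "deriv f z = deriv g z"
proof (rule deriv_cong_ev)
  show "eventually (\<lambda>x. f x = g x) (nhds z)"
    using assms open_disc eventually_nhds by blast
qed simp

text \<open>\<open>linear_op\<close> prescribes values on the disc only, so identities between
  images of an operator reach the norm through this congruence.\<close>

lemma zygmund_norm_cong:
  assumes "\<And>z. z \<in> disc \<Longrightarrow> f z = g z"
  shows "zygmund_norm \<beta> f = zygmund_norm \<beta> g"
proof -
  have d: "deriv f z = deriv g z" if "z \<in> disc" for z
    using assms that by (rule deriv_cong_disc)
  have "deriv (deriv f) z = deriv (deriv g) z" if "z \<in> disc" for z
    using d that by (rule deriv_cong_disc)
  then show ?thesis
    unfolding zygmund_norm_def using assms[of 0] d[of 0] by (simp cong: SUP_cong)
qed

lemma zygmund_weight_le: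
  assumes "f \<in> zygmund_space \<beta>" "z \<in> disc"
  shows "wt \<beta> z * cmod (deriv (deriv f) z) \<le> zygmund_norm \<beta> f"
proof -
  have "wt \<beta> z * cmod (deriv (deriv f) z) \<le> (SUP z\<in>disc. wt \<beta> z * cmod (deriv (deriv f) z))"
    using assms by (intro cSUP_upper) (auto simp: zygmund_space_def)
  then show ?thesis by (simp add: zygmund_norm_def add_increasing)
qed

lemma zygmund_norm_nonneg:
  assumes "f \<in> zygmund_space \<beta>"
  shows "0 \<le> zygmund_norm \<beta> f"
  using order_trans[OF _ zygmund_weight_le[OF assms zero_in_disc]] by simp

lemma zygmund_normI:
  assumes "f holomorphic_on disc"
    and "\<And>z. z \<in> disc \<Longrightarrow> wt \<beta> z * cmod (deriv (deriv f) z) \<le> S"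
  shows "f \<in> zygmund_space \<beta>"
    and "zygmund_norm \<beta> f \<le> cmod (f 0) + cmod (deriv f 0) + S"
proof -
  show "f \<in> zygmund_space \<beta>"
    using assms by (auto simp: zygmund_space_def intro!: bdd_aboveI2)
  have "(SUP z\<in>disc. wt \<beta> z * cmod (deriv (deriv f) z)) \<le> S"
    using assms(2) by (intro cSUP_least) (auto intro: zero_in_disc)
  then show "zygmund_norm \<beta> f \<le> cmod (f 0) + cmod (deriv f 0) + S"
    by (simp add: zygmund_norm_def)
qed

lemma zygmund_lincomb:
  assumes f: "f \<in> zygmund_space \<beta>" and g: "g \<in> zygmund_space \<beta>"
  shows "(\<lambda>z. a * f z + b * g z) \<in> zygmund_space \<beta>" (is "?h \<in> _")
    and "zygmund_norm \<beta> (\<lambda>z. a * f z + b * g z)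
           \<le> cmod a * zygmund_norm \<beta> f + cmod b * zygmund_norm \<beta> g"
proof -
  note hf = zygmund_holomorphic[OF f] and hg = zygmund_holomorphic[OF g]
  have d1: "deriv ?h z = a * deriv f z + b * deriv g z" if "z \<in> disc" for z
    by (rule DERIV_imp_deriv)
      (intro DERIV_add DERIV_cmult deriv_has_field_derivative hf hg that)
  have d2: "deriv (deriv ?h) z = a * deriv (deriv f) z + b * deriv (deriv g) z"
    if "z \<in> disc" for z
  proof -
    have "deriv (deriv ?h) z = deriv (\<lambda>z. a * deriv f z + b * deriv g z) z"
      using d1 that by (rule deriv_cong_disc)
    also have "\<dots> = a * deriv (deriv f) z + b * deriv (deriv g) z"
      by (rule DERIV_imp_deriv)
        (intro DERIV_add DERIV_cmult deriv_has_field_derivative deriv_holomorphic_disc hf hg that)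
    finally show ?thesis .
  qed
  let ?S = "\<lambda>f. SUP z\<in>disc. wt \<beta> z * cmod (deriv (deriv f) z)"
  have up: "wt \<beta> z * cmod (deriv (deriv f) z) \<le> ?S f"
    if "f \<in> zygmund_space \<beta>" "z \<in> disc" for f z
    using that by (intro cSUP_upper) (auto simp: zygmund_space_def)
  have bd: "wt \<beta> z * cmod (deriv (deriv ?h) z) \<le> cmod a * ?S f + cmod b * ?S g"
    if z: "z \<in> disc" for z
  proof -
    have "wt \<beta> z * cmod (deriv (deriv ?h) z)
        \<le> wt \<beta> z * (cmod a * cmod (deriv (deriv f) z) + cmod b * cmod (deriv (deriv g) z))"
      unfolding d2[OF z]
      by (intro mult_left_mono wt_nonneg order_trans[OF norm_triangle_ineq]) (simp add: norm_mult)
    also have "\<dots> = cmod a * (wt \<beta> z * cmod (deriv (deriv f) z))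
        + cmod b * (wt \<beta> z * cmod (deriv (deriv g) z))"
      by (simp add: algebra_simps)
    also have "\<dots> \<le> cmod a * ?S f + cmod b * ?S g"
      by (intro add_mono mult_left_mono up f g z) auto
    finally show ?thesis .
  qed
  have hh: "?h holomorphic_on disc"
    using hf hg by (intro holomorphic_intros)
  note * = zygmund_normI[OF hh bd]
  show "?h \<in> zygmund_space \<beta>" by (rule *(1))
  have "cmod (?h 0) \<le> cmod a * cmod (f 0) + cmod b * cmod (g 0)"
    by (rule order_trans[OF norm_triangle_ineq]) (simp add: norm_mult)
  moreover have "cmod (deriv ?h 0) \<le> cmod a * cmod (deriv f 0) + cmod b * cmod (deriv g 0)"
    unfolding d1[OF zero_in_disc]
    by (rule order_trans[OF norm_triangle_ineq]) (simp add: norm_mult)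
  ultimately show "zygmund_norm \<beta> ?h
           \<le> cmod a * zygmund_norm \<beta> f + cmod b * zygmund_norm \<beta> g"
    using *(2) by (simp add: zygmund_norm_def algebra_simps)
qed

lemma zygmund_diff:
  assumes "f \<in> zygmund_space \<beta>" "g \<in> zygmund_space \<beta>"
  shows "(\<lambda>z. f z - g z) \<in> zygmund_space \<beta>"
    and "zygmund_norm \<beta> (\<lambda>z. f z - g z) \<le> zygmund_norm \<beta> f + zygmund_norm \<beta> g"
  using zygmund_lincomb[OF assms, of 1 "-1"] by simp_all

lemma zygmund_norm_triangle_sub:
  assumes "f \<in> zygmund_space \<beta>" "g \<in> zygmund_space \<beta>"
  shows "zygmund_norm \<beta> f \<le> zygmund_norm \<beta> (\<lambda>z. f z - g z) + zygmund_norm \<beta> g"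
  using zygmund_lincomb(2)[OF zygmund_diff(1)[OF assms] assms(2), of 1 1] by simp

lemma zygmund_sum:
  fixes h :: "nat \<Rightarrow> complex \<Rightarrow> complex"
  assumes "\<And>k. h k \<in> zygmund_space \<beta>"
  shows "(\<lambda>z. \<Sum>k<N. h k z) \<in> zygmund_space \<beta> \<and>
    zygmund_norm \<beta> (\<lambda>z. \<Sum>k<N. h k z) \<le> (\<Sum>k<N. zygmund_norm \<beta> (h k))"
proof (induction N)
  case 0
  have "wt \<beta> z * cmod (deriv (deriv (\<lambda>z. 0)) z) \<le> 0" for z
    by simp
  from zygmund_normI[OF _ this] show ?case by simp
next
  case (Suc N)
  then show ?case
    using zygmund_lincomb[of "\<lambda>z. \<Sum>k<N. h k z" \<beta> "h N" 1 1] assms[of N] by simp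
qed

section \<open>Derivatives and growth estimates\<close>

lemma wcomp_deriv:
  assumes u: "u holomorphic_on disc" and p: "\<phi> holomorphic_on disc" and pd: "\<phi> ` disc \<subseteq> disc"
    and h: "h holomorphic_on disc" and z: "z \<in> disc"
  shows "deriv (wcomp u \<phi> h) z = deriv u z * h (\<phi> z) + u z * deriv \<phi> z * deriv h (\<phi> z)"
    and "deriv (deriv (wcomp u \<phi> h)) z = deriv (deriv u) z * h (\<phi> z)
      + (2 * deriv u z * deriv \<phi> z + u z * deriv (deriv \<phi>) z) * deriv h (\<phi> z)
      + u z * (deriv \<phi> z)^2 * deriv (deriv h) (\<phi> z)"
proof -
  have D: "(deriv f has_field_derivative deriv (deriv f) z) (at z)"
    if "f holomorphic_on disc" "z \<in> disc" for f z
    by (intro deriv_has_field_derivative deriv_holomorphic_disc that)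
  have chain: "((\<lambda>z. f (\<phi> z)) has_field_derivative deriv f (\<phi> z) * deriv \<phi> z) (at z)"
    if "f holomorphic_on disc" "z \<in> disc" for f z
    using pd by (intro DERIV_chain2 deriv_has_field_derivative that p) (use that in auto)
  have 1: "deriv (wcomp u \<phi> h) z = deriv u z * h (\<phi> z) + u z * deriv \<phi> z * deriv h (\<phi> z)"
    if z: "z \<in> disc" for z
    unfolding wcomp_def
    by (rule DERIV_imp_deriv)
      (auto intro!: derivative_eq_intros deriv_has_field_derivative[OF u z] chain[OF h z])
  then show "deriv (wcomp u \<phi> h) z = deriv u z * h (\<phi> z) + u z * deriv \<phi> z * deriv h (\<phi> z)"
    using z .
  have "deriv (deriv (wcomp u \<phi> h)) z
      = deriv (\<lambda>z. deriv u z * h (\<phi> z) + u z * deriv \<phi> z * deriv h (\<phi> z)) z"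
    using 1 z by (rule deriv_cong_disc)
  also have "\<dots> = deriv (deriv u) z * h (\<phi> z)
      + (2 * deriv u z * deriv \<phi> z + u z * deriv (deriv \<phi>) z) * deriv h (\<phi> z)
      + u z * (deriv \<phi> z)^2 * deriv (deriv h) (\<phi> z)"
    by (rule DERIV_imp_deriv)
      (auto intro!: derivative_eq_intros deriv_has_field_derivative[OF u z] chain[OF h z]
         D[OF u z] D[OF p z] chain[OF deriv_holomorphic_disc[OF h] z]
       simp: algebra_simps power2_eq_square)
  finally show "deriv (deriv (wcomp u \<phi> h)) z = deriv (deriv u) z * h (\<phi> z)
      + (2 * deriv u z * deriv \<phi> z + u z * deriv (deriv \<phi>) z) * deriv h (\<phi> z)
      + u z * (deriv \<phi> z)^2 * deriv (deriv h) (\<phi> z)" .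
qed

lemma wcomp_holomorphic:
  assumes "u holomorphic_on disc" "\<phi> holomorphic_on disc" "\<phi> ` disc \<subseteq> disc" "h holomorphic_on disc"
  shows "wcomp u \<phi> h holomorphic_on disc"
  unfolding wcomp_def
  using holomorphic_on_mult[OF assms(1) holomorphic_on_compose_gen[OF assms(2,4,3)]]
  by (simp add: o_def)

text \<open>Cauchy's estimate on the circle of radius R = (1 - |w|)/2 about w: there 1 - |x| is
  still at least R, so g is at most M R^(-s), and dividing by R raises the exponent by one. The
  powers of 2 come from the halved radius.\<close>

lemma deriv_growth:
  assumes g: "g holomorphic_on disc" and s: "0 \<le> s" and w: "w \<in> disc"
    and bd: "\<And>w. w \<in> disc \<Longrightarrow> cmod (g w) \<le> M * (1 - cmod w) powr (-s)"
  shows "cmod (deriv g w) \<le> M * 2 powr (s + 1) * (1 - cmod w) powr (-(s + 1))"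
proof -
  define R where "R = (1 - cmod w) / 2"
  have R: "0 < R" using w by (simp add: R_def in_disc)
  have M: "0 \<le> M" using order_trans[OF norm_ge_zero bd[OF zero_in_disc]] by simp
  have sub: "cball w R \<subseteq> disc"
  proof
    fix x assume "x \<in> cball w R"
    then have "cmod x \<le> cmod w + R"
      using norm_triangle_sub[of x w] by (simp add: dist_norm norm_minus_commute)
    also have "\<dots> < 1" using w by (simp add: in_disc R_def field_simps)
    finally show "x \<in> disc" by (simp add: in_disc)
  qed
  have "cmod ((deriv ^^ 1) g w) \<le> fact 1 * (M * R powr (-s)) / R ^ 1"
  proof (rule Cauchy_inequality)
    show "g holomorphic_on ball w R"
      using g sub by (meson ball_subset_cball holomorphic_on_subset)
    show "continuous_on (cball w R) g"
      using g sub by (meson holomorphic_on_imp_continuous_on holomorphic_on_subset)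
    show "0 < R" by fact
    fix x assume x: "cmod (w - x) = R"
    then have xd: "x \<in> disc" using sub by (auto simp: dist_norm)
    have "cmod x \<le> cmod w + R" using x norm_triangle_sub[of x w] by (simp add: norm_minus_commute)
    then have "R \<le> 1 - cmod x" by (simp add: R_def field_simps)
    then have "(1 - cmod x) powr (-s) \<le> R powr (-s)"
      using R s by (intro powr_mono2') auto
    then show "cmod (g x) \<le> M * R powr (-s)"
      using bd[OF xd] M by (meson mult_left_mono order_trans)
  qed
  also have "fact 1 * (M * R powr (-s)) / R ^ 1 = M * R powr (-(s + 1))"
    using R by (simp add: powr_diff powr_minus field_simps powr_add)
  also have "R powr (-(s + 1)) = 2 powr (s + 1) * (1 - cmod w) powr (-(s + 1))"
    using w powr_minus_divide[of 2 "-(s + 1)"] by (simp add: R_def powr_divide in_disc add.commute)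
  finally show ?thesis by (simp add: mult.assoc)
qed

section \<open>Pointwise growth and dilation on the unit ball of the Bloch-type space\<close>

lemma bloch_deriv_le:
  assumes "f \<in> bloch_space \<alpha>" "bloch_norm \<alpha> f \<le> 1" "0 \<le> \<alpha>" "w \<in> disc"
  shows "cmod (deriv f w) \<le> (1 - cmod w) powr (-\<alpha>)"
proof -
  have r: "cmod w < 1" using assms by (simp add: in_disc)
  have "wt \<alpha> w * cmod (deriv f w) \<le> (SUP z\<in>disc. wt \<alpha> z * cmod (deriv f z))"
    using assms by (intro cSUP_upper) (auto simp: bloch_space_def)
  also have "\<dots> \<le> 1" using assms(2) norm_ge_zero[of "f 0"] unfolding bloch_norm_def by linarith
  finally have 1: "wt \<alpha> w * cmod (deriv f w) \<le> 1" .
  have "(1 - cmod w) powr \<alpha> \<le> wt \<alpha> w"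
    using r assms(3) by (intro powr_mono2) (auto simp: power2_eq_square mult_left_le)
  then have "(1 - cmod w) powr \<alpha> * cmod (deriv f w) \<le> 1"
    using 1 by (meson mult_right_mono norm_ge_zero order_trans)
  then show ?thesis using r by (simp add: powr_minus field_simps)
qed

text \<open>The derivative bound is integrated along the radius from 0 to w. \<open>?G\<close> is an
  antiderivative of |w| (1 - t|w|)^(-\<alpha>), which explains the factor 1/(\<alpha>-1).\<close>

lemma bloch_growth:
  assumes f: "f \<in> bloch_space \<alpha>" "bloch_norm \<alpha> f \<le> 1" and a: "1 < \<alpha>" and w: "w \<in> disc"
  shows "cmod (f w) \<le> (1 + 1 / (\<alpha> - 1)) * (1 - cmod w) powr (-(\<alpha> - 1))"
proof -
  have r: "cmod w < 1" using w by (simp add: in_disc)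
  have hol: "f holomorphic_on disc" using f by (simp add: bloch_space_def)
  let ?G = "\<lambda>t. (1 - t * cmod w) powr (1 - \<alpha>) / (\<alpha> - 1)"
  have tw: "of_real t * w \<in> disc" "t * cmod w < 1" if "0 \<le> t" "t \<le> 1" for t
  proof -
    have "t * cmod w \<le> cmod w" using that by (simp add: mult_left_le_one_le)
    then show "t * cmod w < 1" using r by simp
    then show "of_real t * w \<in> disc" using that by (simp add: in_disc norm_mult)
  qed
  have DF: "((\<lambda>t. f (of_real t * w)) has_vector_derivative w * deriv f (of_real t * w)) (at t)"
    if "0 \<le> t" "t \<le> 1" for t
  proof -
    have "((\<lambda>t. of_real t * w) has_vector_derivative w) (at t)"
      by (auto intro!: derivative_eq_intros)
    then show ?thesis
      using field_vector_diff_chain_at[of "\<lambda>t. of_real t * w" w t f]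
        deriv_has_field_derivative[OF hol tw(1)[OF that]] by (simp add: o_def)
  qed
  have DG: "(?G has_real_derivative cmod w * (1 - t * cmod w) powr (-\<alpha>)) (at t)"
    if "0 \<le> t" "t \<le> 1" for t
  proof -
    have "((\<lambda>t. (1 - t * cmod w) powr (1 - \<alpha>)) has_real_derivative
        (\<alpha> - 1) * (cmod w * (1 - t * cmod w) powr (-\<alpha>))) (at t)"
      using tw(2)[OF that] by (auto intro!: derivative_eq_intros simp: algebra_simps)
    from DERIV_cdivide[OF this, of "\<alpha> - 1"] show ?thesis using a by simp
  qed
  have "cmod (f (of_real 1 * w) - f (of_real 0 * w)) \<le> ?G 1 - ?G 0"
  proof (rule differentiable_bound_general[where f = "\<lambda>t. f (of_real t * w)" and \<phi> = ?G])
    show "continuous_on {0..1} (\<lambda>t. f (of_real t * w))"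
      by (intro continuous_at_imp_continuous_on ballI has_vector_derivative_continuous[OF DF]) auto
    show "continuous_on {0..1} ?G"
      by (intro continuous_at_imp_continuous_on ballI DERIV_isCont[OF DG]) auto
    show "((\<lambda>t. f (of_real t * w)) has_vector_derivative w * deriv f (of_real t * w)) (at t)"
      if "0 < t" "t < 1" for t using DF that by simp
    show "(?G has_vector_derivative cmod w * (1 - t * cmod w) powr (-\<alpha>)) (at t)"
      if "0 < t" "t < 1" for t
      using DG that by (simp add: has_real_derivative_iff_has_vector_derivative)
    show "cmod (w * deriv f (of_real t * w)) \<le> cmod w * (1 - t * cmod w) powr (-\<alpha>)"
      if "0 < t" "t < 1" for t
      using bloch_deriv_le[OF f _ tw(1)] that a
      by (auto simp: norm_mult intro!: mult_left_mono)
  qed auto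
  then have "cmod (f w - f 0) \<le> (1 - cmod w) powr (1 - \<alpha>) / (\<alpha> - 1)"
    using a by (smt (verit) divide_nonneg_pos mult_1 mult_zero_left of_real_0 of_real_1 powr_ge_zero)
  moreover have "cmod (f 0) \<le> 1"
  proof -
    have "wt \<alpha> 0 * cmod (deriv f 0) \<le> (SUP z\<in>disc. wt \<alpha> z * cmod (deriv f z))"
      using f by (intro cSUP_upper) (auto simp: bloch_space_def)
    from order_trans[OF _ this] have "0 \<le> (SUP z\<in>disc. wt \<alpha> z * cmod (deriv f z))" by simp
    then show ?thesis using f(2) by (simp add: bloch_norm_def)
  qed
  \<comment> \<open>This lets |f(0)| \<le> 1 be absorbed into the power, giving the summand 1 in the
    constant.\<close>
  moreover have "1 \<le> (1 - cmod w) powr (1 - \<alpha>)"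
    using powr_mono2'[of "1 - \<alpha>" "1 - cmod w" 1] r a by simp
  ultimately show ?thesis
    using norm_triangle_sub[of "f w" "f 0"] by (simp add: algebra_simps)
qed

text \<open>The mean value inequality on the closed ball of radius |w|, which contains both points.
  The small factor 1 - r is paid for with the exponent \<alpha> instead of \<alpha>-1, so this is
  useful only where |w| stays away from 1.\<close>

lemma bloch_dilate_diff:
  assumes f: "f \<in> bloch_space \<alpha>" "bloch_norm \<alpha> f \<le> 1" and a: "0 \<le> \<alpha>" and w: "w \<in> disc"
    and r: "0 \<le> r" "r \<le> 1"
  shows "cmod (f w - f (of_real r * w)) \<le> (1 - r) * (1 - cmod w) powr (-\<alpha>)"
proof -
  have w1: "cmod w < 1" using w by (simp add: in_disc)
  have hol: "f holomorphic_on disc" using f by (simp add: bloch_space_def)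
  have "cmod (f w - f (of_real r * w)) \<le> (1 - cmod w) powr (-\<alpha>) * cmod (w - of_real r * w)"
  proof (rule field_differentiable_bound[where S = "cball 0 (cmod w)" and f' = "deriv f"])
    fix z :: complex assume "z \<in> cball 0 (cmod w)"
    then have z: "cmod z \<le> cmod w" by simp
    then have zd: "z \<in> disc" using w1 by (simp add: in_disc)
    show "(f has_field_derivative deriv f z) (at z within cball 0 (cmod w))"
      using deriv_has_field_derivative[OF hol zd] by (rule has_field_derivative_at_within)
    have "(1 - cmod z) powr (-\<alpha>) \<le> (1 - cmod w) powr (-\<alpha>)"
      using z w1 a by (intro powr_mono2') auto
    then show "cmod (deriv f z) \<le> (1 - cmod w) powr (-\<alpha>)"
      using bloch_deriv_le[OF f a zd] by linarith
  qed (use r in \<open>auto simp: norm_mult mult_left_le_one_le\<close>)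
  also have "cmod (w - of_real r * w) = (1 - r) * cmod w"
  proof -
    have "w - of_real r * w = of_real (1 - r) * w" by (simp add: algebra_simps)
    then show ?thesis using r by (simp only: norm_mult norm_of_real)
  qed
  also have "(1 - cmod w) powr (-\<alpha>) * ((1 - r) * cmod w) \<le> (1 - cmod w) powr (-\<alpha>) * (1 - r)"
    using r w1 by (intro mult_left_mono) (auto simp: mult_left_le)
  finally show ?thesis by (simp add: mult.commute)
qed

section \<open>Compact operators on lacunary monomials\<close>

text \<open>Terms with y \<le> 1 form a geometric sum dominated by twice the last one, and terms
  with y > 1 decay geometrically. The invariant 2 y, respectively 4 - 1/y, of the induction encodes
  both phases; the doubling of y closes each step.\<close>

lemma lacunary_sum_le:
  fixes y :: "nat \<Rightarrow> real"
  assumes pos: "\<And>k. 0 < y k" and lac: "\<And>k. 2 * y k \<le> y (Suc k)"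
  shows "(\<Sum>k<N. min (y k) (1 / y k)) \<le> 4"
proof -
  have "(\<Sum>k\<le>n. min (y k) (1 / y k)) \<le> (if y n \<le> 1 then 2 * y n else 4 - 1 / y n)" for n
  proof (induction n)
    case 0
    then show ?case using pos[of 0] by (auto simp: min_def field_simps)
  next
    case (Suc n)
    note p = pos[of n] pos[of "Suc n"] and l = lac[of n]
    consider "y (Suc n) \<le> 1" | "y n \<le> 1" "1 < y (Suc n)" | "1 < y n" "1 < y (Suc n)"
      using p l by linarith
    then show ?case
    proof cases
      case 1
      then have "y n \<le> 1" using p l by linarith
      then show ?thesis using 1 Suc l min.cobounded1[of "y (Suc n)" "1 / y (Suc n)"] by simp
    next
      case 2
      then have "1 / y (Suc n) \<le> 1" by simp
      moreover have "(\<Sum>k\<le>n. min (y k) (1 / y k)) \<le> 2" using 2 Suc by simp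
      moreover have "min (y (Suc n)) (1 / y (Suc n)) \<le> 1 / y (Suc n)" by (rule min.cobounded2)
      ultimately have "(\<Sum>k\<le>n. min (y k) (1 / y k)) + min (y (Suc n)) (1 / y (Suc n))
          \<le> 4 - 1 / y (Suc n)" by linarith
      then show ?thesis using 2 by simp
    next
      case 3
      have "1 / y (Suc n) \<le> 1 / (2 * y n)" using p l by (intro divide_left_mono) auto
      then show ?thesis using 3 Suc min.cobounded2[of "y (Suc n)" "1 / y (Suc n)"] by simp
    qed
  qed
  note * = this
  show ?thesis
  proof (cases N)
    case (Suc n)
    have "0 < 1 / y n" using pos[of n] by simp
    then have "(\<Sum>k\<le>n. min (y k) (1 / y k)) \<le> 4" using *[of n] by (smt (verit))
    then show ?thesis using Suc by (simp add: lessThan_Suc_atMost)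
  qed simp
qed

section \<open>Lacunary polynomials in the unit ball\<close>

lemma powr_le_exp:
  fixes y p :: real
  assumes "0 \<le> y" "0 < p"
  shows "y powr p \<le> p powr p * exp y"
proof -
  have "y / p \<le> exp (y / p)" using exp_ge_add_one_self[of "y / p"] by linarith
  then have "(y / p) powr p \<le> exp (y / p) powr p" using assms by (intro powr_mono2) auto
  also have "\<dots> = exp y" using assms by (simp add: powr_def)
  finally show ?thesis using assms by (simp add: powr_divide field_simps)
qed

text \<open>The weighted derivative of z^m lives near 1 - x = 1/m and decays on both sides of it,
  which makes contributions of different scales summable. For y \<le> 1 the exponent \<alpha> \<ge>
  1 gives decay like y. For y > 1, x^(m-1) \<le> exp(1 - y), and the exponential beats
  y^(\<alpha>+1) with constant (\<alpha>+1)^(\<alpha>+1).\<close>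

lemma power_weight_le:
  fixes \<alpha> x :: real
  assumes a: "1 \<le> \<alpha>" and x: "0 \<le> x" "x < 1" and m: "1 \<le> m"
  defines "y \<equiv> real m * (1 - x)"
  shows "y powr \<alpha> * x ^ (m - 1) \<le> exp 1 * (\<alpha> + 1) powr (\<alpha> + 1) * min y (1 / y)"
proof -
  have y: "0 < y" using x m by (simp add: y_def)
  show ?thesis
  proof (cases "y \<le> 1")
    case True
    have "(1::real) * 1 \<le> exp 1 * (\<alpha> + 1) powr (\<alpha> + 1)"
      using a by (intro mult_mono ge_one_powr_ge_zero) auto
    moreover have "y powr \<alpha> * x ^ (m - 1) \<le> y * 1"
      using powr_mono'[of 1 \<alpha> y] True y a x by (intro mult_mono power_le_one) auto
    moreover have "min y (1 / y) = y" using True y by (simp add: min_def field_simps mult_le_one)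
    ultimately show ?thesis
      using y by (smt (verit) mult.commute mult_le_cancel_left1 mult_1)
  next
    case False
    have "x ^ (m - 1) \<le> exp (-(1 - x)) ^ (m - 1)"
      using x exp_ge_add_one_self[of "-(1 - x)"] by (intro power_mono) auto
    also have "\<dots> = exp (real (m - 1) * -(1 - x))" by (simp add: exp_of_nat_mult)
    also have "\<dots> \<le> exp (1 - y)"
      using m x by (simp add: y_def of_nat_diff algebra_simps)
    finally have "x ^ (m - 1) \<le> exp (1 - y)" .
    then have "y * (y powr \<alpha> * x ^ (m - 1)) \<le> y powr (\<alpha> + 1) * exp (1 - y)"
      using y by (simp add: powr_add mult.commute mult_left_mono)
    also have "\<dots> \<le> ((\<alpha> + 1) powr (\<alpha> + 1) * exp y) * exp (1 - y)"
      using y a by (intro mult_right_mono powr_le_exp) auto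
    also have "\<dots> = exp 1 * (\<alpha> + 1) powr (\<alpha> + 1)"
      by (simp add: mult.assoc flip: exp_add)
    finally have "y powr \<alpha> * x ^ (m - 1) \<le> exp 1 * (\<alpha> + 1) powr (\<alpha> + 1) * (1 / y)"
      using y by (simp add: field_simps)
    moreover have "min y (1 / y) = 1 / y"
      using False y by (smt (verit) divide_le_eq_1_pos min_def)
    ultimately show ?thesis by simp
  qed
qed

lemma bloch_normI:
  assumes "f holomorphic_on disc" "f 0 = 0"
    and "\<And>z. z \<in> disc \<Longrightarrow> wt \<alpha> z * cmod (deriv f z) \<le> S"
  shows "f \<in> bloch_space \<alpha>" and "bloch_norm \<alpha> f \<le> S"
proof -
  show "f \<in> bloch_space \<alpha>"
    using assms by (auto simp: bloch_space_def intro!: bdd_aboveI2)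
  have "(SUP z\<in>disc. wt \<alpha> z * cmod (deriv f z)) \<le> S"
    using assms(3) by (intro cSUP_least) (auto intro: zero_in_disc)
  then show "bloch_norm \<alpha> f \<le> S" using assms(2) by (simp add: bloch_norm_def)
qed

text \<open>At a fixed |z| = x, the terms of the weighted derivative are controlled by min(y, 1/y)
  with y = q (1 - x). These y at least double from one term to the next, so the bound depends
  neither on the number of terms nor on the chosen degrees.\<close>

lemma lacunary_monomials:
  assumes a: "1 \<le> \<alpha>"
  obtains c :: real where "0 < c"
    "\<And>(q :: nat \<Rightarrow> nat) N. \<lbrakk>\<And>k. 1 \<le> q k; \<And>k. 2 * q k \<le> q (Suc k)\<rbrakk> \<Longrightarrow>
      (\<lambda>z. \<Sum>k<N. of_real (c * real (q k) powr (\<alpha> - 1)) * z ^ q k) \<in> bloch_space \<alpha> \<and>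
      bloch_norm \<alpha> (\<lambda>z. \<Sum>k<N. of_real (c * real (q k) powr (\<alpha> - 1)) * z ^ q k) \<le> 1"
proof
  define C where "C = exp 1 * (\<alpha> + 1) powr (\<alpha> + 1)"
  have C: "0 < C" using a by (simp add: C_def)
  \<comment> \<open>The 4 is the bound for the lacunary sum, 2^\<alpha> comes from 1 - x^2 \<le> 2
    (1 - x), and \<open>C\<close> from the estimate of one weighted power.\<close>
  define c where "c = 1 / (4 * 2 powr \<alpha> * C)"
  show c: "0 < c" using C by (simp add: c_def)
  fix q :: "nat \<Rightarrow> nat" and N
  assume q: "\<And>k. 1 \<le> q k" and lac: "\<And>k. 2 * q k \<le> q (Suc k)"
  define F where "F = (\<lambda>z. \<Sum>k<N. complex_of_real (c * real (q k) powr (\<alpha> - 1)) * z ^ q k)"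
  have bd: "wt \<alpha> z * cmod (deriv F z) \<le> 1" if "z \<in> disc" for z
  proof -
    define x where "x = cmod z"
    have x: "0 \<le> x" "x < 1" using that by (auto simp: x_def in_disc)
    define y where "y = (\<lambda>k. real (q k) * (1 - x))"
    have y: "0 < y k" for k using q[of k] x by (simp add: y_def)
    have yl: "2 * y k \<le> y (Suc k)" for k
    proof -
      have "2 * real (q k) \<le> real (q (Suc k))" using lac[of k] by linarith
      then show ?thesis using x by (simp add: y_def flip: mult.assoc)
    qed
    have "deriv F z = (\<Sum>k<N. of_real (c * real (q k) powr (\<alpha> - 1)) * (of_nat (q k) * z ^ (q k - 1)))"
      unfolding F_def
      by (rule DERIV_imp_deriv) (auto intro!: derivative_eq_intros sum.cong simp: mult_ac)
    then have "cmod (deriv F z)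
        \<le> (\<Sum>k<N. cmod (of_real (c * real (q k) powr (\<alpha> - 1)) * (of_nat (q k) * z ^ (q k - 1))))"
      by (simp only: norm_sum)
    also have "\<dots> = (\<Sum>k<N. c * (real (q k) powr \<alpha> * x ^ (q k - 1)))"
    proof (rule sum.cong)
      fix k
      show "cmod (of_real (c * real (q k) powr (\<alpha> - 1)) * (of_nat (q k) * z ^ (q k - 1)))
          = c * (real (q k) powr \<alpha> * x ^ (q k - 1))"
        using c q[of k] by (simp add: norm_mult norm_power x_def powr_diff)
    qed simp
    finally have 1: "cmod (deriv F z) \<le> (\<Sum>k<N. c * (real (q k) powr \<alpha> * x ^ (q k - 1)))" .
    have "1 - x\<^sup>2 \<le> 2 * (1 - x)"
      using zero_le_power2[of "1 - x"] by (simp add: power2_eq_square algebra_simps)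
    moreover have "0 \<le> 1 - x\<^sup>2" using x by (simp add: abs_square_le_1)
    ultimately have w: "wt \<alpha> z \<le> 2 powr \<alpha> * (1 - x) powr \<alpha>"
      using powr_mono2[of \<alpha> "1 - x\<^sup>2" "2 * (1 - x)"] x a powr_mult[of 2 "1 - x" \<alpha>]
      unfolding x_def by linarith
    have "wt \<alpha> z * cmod (deriv F z)
        \<le> (2 powr \<alpha> * (1 - x) powr \<alpha>) * (\<Sum>k<N. c * (real (q k) powr \<alpha> * x ^ (q k - 1)))"
      using 1 w by (intro mult_mono) auto
    also have "\<dots> = 2 powr \<alpha> * c * (\<Sum>k<N. y k powr \<alpha> * x ^ (q k - 1))"
      unfolding sum_distrib_left using x by (intro sum.cong) (auto simp: y_def powr_mult)
    also have "\<dots> \<le> 2 powr \<alpha> * c * (\<Sum>k<N. C * min (y k) (1 / y k))"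
      unfolding y_def C_def using a x q c
      by (intro mult_left_mono sum_mono power_weight_le) auto
    also have "\<dots> \<le> 2 powr \<alpha> * c * (C * 4)"
      unfolding sum_distrib_left[symmetric] using c C lacunary_sum_le[of y, OF y yl]
      by (intro mult_left_mono) auto
    also have "\<dots> = 1" using C by (simp add: c_def)
    finally show ?thesis .
  qed
  have hol: "F holomorphic_on disc" unfolding F_def by (intro holomorphic_intros)
  have F0: "F 0 = 0" unfolding F_def
  proof (intro sum.neutral ballI)
    fix k
    show "complex_of_real (c * real (q k) powr (\<alpha> - 1)) * 0 ^ q k = 0" using q[of k] by simp
  qed
  from bloch_normI[OF hol F0 bd]
  show "(\<lambda>z. \<Sum>k<N. of_real (c * real (q k) powr (\<alpha> - 1)) * z ^ q k) \<in> bloch_space \<alpha> \<and>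
      bloch_norm \<alpha> (\<lambda>z. \<Sum>k<N. of_real (c * real (q k) powr (\<alpha> - 1)) * z ^ q k) \<le> 1"
    by (simp add: F_def)
qed

section \<open>Compact operators: boundedness and vanishing along normalised monomials\<close>

lemma compact_op_bounded:
  assumes K: "compact_op X nX (zygmund_space \<beta>) (zygmund_norm \<beta>) K"
  obtains B where "\<And>f. f \<in> X \<Longrightarrow> nX f \<le> 1 \<Longrightarrow> zygmund_norm \<beta> (K f) \<le> B"
proof -
  have "\<exists>B. \<forall>f\<in>X. nX f \<le> 1 \<longrightarrow> zygmund_norm \<beta> (K f) \<le> B"
  proof (rule ccontr)
    assume "\<not> ?thesis"
    then have "\<forall>n::nat. \<exists>f. f \<in> X \<and> nX f \<le> 1 \<and> real n < zygmund_norm \<beta> (K f)"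
      by (meson not_le)
    then obtain f where f: "\<And>n. f n \<in> X" "\<And>n. nX (f n) \<le> 1"
      and big: "\<And>n. real n < zygmund_norm \<beta> (K (f n))"
      by metis
    then obtain r g where r: "strict_mono r" and g: "g \<in> zygmund_space \<beta>"
      and lim: "(\<lambda>n. zygmund_norm \<beta> (\<lambda>z. K (f (r n)) z - g z)) \<longlonglongrightarrow> 0"
      using K unfolding compact_op_def by blast
    have KY: "K (f n) \<in> zygmund_space \<beta>" for n
      using K f unfolding compact_op_def linear_op_def by blast
    have "eventually (\<lambda>n. zygmund_norm \<beta> (\<lambda>z. K (f (r n)) z - g z) < 1) sequentially"
      using lim by (rule order_tendstoD) simp
    moreover have "eventually (\<lambda>n. zygmund_norm \<beta> g + 1 \<le> real n) sequentially"
      using filterlim_real_sequentially by (simp add: filterlim_at_top)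
    ultimately have "eventually (\<lambda>n. zygmund_norm \<beta> (\<lambda>z. K (f (r n)) z - g z) < 1 \<and>
        zygmund_norm \<beta> g + 1 \<le> real n) sequentially"
      by (rule eventually_conj)
    then obtain n where n: "zygmund_norm \<beta> (\<lambda>z. K (f (r n)) z - g z) < 1"
        "zygmund_norm \<beta> g + 1 \<le> real n"
      unfolding eventually_sequentially by blast
    \<comment> \<open>The image of \<open>f (r n)\<close> has norm above \<open>r n\<close>, hence
      above n, while closeness to \<open>g\<close> keeps it below the norm of \<open>g\<close> plus
      1.\<close>
    have "n \<le> r n" using r by (rule strict_mono_imp_increasing)
    then show False
      using zygmund_norm_triangle_sub[OF KY g, of "r n"] n big[of "r n"] by linarith
  qed
  then show ?thesis using that by blast
qed

lemma linear_op_lincomb: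
  assumes "linear_op X Y K" "f \<in> X" "g \<in> X" "z \<in> disc"
  shows "K (\<lambda>w. a * f w + b * g w) z = a * K f z + b * K g z"
  using assms by (simp add: linear_op_def)

lemma linear_op_sum:
  fixes f :: "nat \<Rightarrow> complex \<Rightarrow> complex"
  assumes K: "linear_op X Y K" and f: "\<And>k. f k \<in> X"
    and s: "\<And>N. (\<lambda>z. \<Sum>k<N. f k z) \<in> X" and z: "z \<in> disc"
  shows "K (\<lambda>z. \<Sum>k<N. f k z) z = (\<Sum>k<N. K (f k) z)"
proof (induction N)
  case 0
  \<comment> \<open>The zero function is reached as a combination with zero coefficients.\<close>
  have "K (\<lambda>w. 0 * f 0 w + 0 * f 0 w) z = 0 * K (f 0) z + 0 * K (f 0) z"
    by (rule linear_op_lincomb[OF K f f z])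
  then show ?case by simp
next
  case (Suc N)
  have "K (\<lambda>w. 1 * (\<Sum>k<N. f k w) + 1 * f N w) z = 1 * K (\<lambda>z. \<Sum>k<N. f k z) z + 1 * K (f N) z"
    by (rule linear_op_lincomb[OF K s f z])
  then show ?case using Suc by simp
qed

text \<open>A substitute for weak convergence to 0: a norm limit \<open>g\<close> of a subsequence of \<open>K (f m)\<close>
  is also the limit of averages \<open>K (\<Sum>k<N. f (q k)) / N\<close>, which are \<open>O(1/N)\<close>.\<close>
lemma compact_op_lacunary_tendsto_0:
  fixes f :: "nat \<Rightarrow> complex \<Rightarrow> complex"
  assumes K: "compact_op X nX (zygmund_space \<beta>) (zygmund_norm \<beta>) K"
    and sums: "\<And>(q :: nat \<Rightarrow> nat) N. \<lbrakk>\<And>k. 1 \<le> q k; \<And>k. 2 * q k \<le> q (Suc k)\<rbrakk> \<Longrightarrow>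
      (\<lambda>z. \<Sum>k<N. f (q k) z) \<in> X \<and> nX (\<lambda>z. \<Sum>k<N. f (q k) z) \<le> 1"
    and e: "0 < \<epsilon>"
  shows "eventually (\<lambda>m. zygmund_norm \<beta> (K (f m)) < \<epsilon>) sequentially"
proof (rule ccontr)
  assume "\<not> ?thesis"
  then have freq: "\<exists>m\<ge>M. \<epsilon> \<le> zygmund_norm \<beta> (K (f m))" for M
    by (auto simp: eventually_sequentially not_less)
  \<comment> \<open>A single function is the one-term sum of the lacunary sequence m, 2m, 4m,
    ...\<close>
  have fX: "f m \<in> X \<and> nX (f m) \<le> 1" if "1 \<le> m" for m
    using sums[of "\<lambda>k. m * 2 ^ k" 1] that by simp
  have lin: "linear_op X (zygmund_space \<beta>) K" using K by (simp add: compact_op_def)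
  have KY: "K h \<in> zygmund_space \<beta>" if "h \<in> X" for h
    using lin that by (simp add: linear_op_def)
  obtain B where B: "\<And>h. h \<in> X \<Longrightarrow> nX h \<le> 1 \<Longrightarrow> zygmund_norm \<beta> (K h) \<le> B"
    using compact_op_bounded[OF K] by blast
  \<comment> \<open>If the norms do not tend to 0, arbitrarily large degrees with images of norm at
    least \<epsilon> exist, so they can be chosen to at least double each time.\<close>
  have "\<exists>s. \<forall>k. (1 \<le> s k \<and> \<epsilon> \<le> zygmund_norm \<beta> (K (f (s k)))) \<and> 2 * s k \<le> s (Suc k)"
  proof (rule dependent_nat_choice)
    show "\<exists>x. 1 \<le> x \<and> \<epsilon> \<le> zygmund_norm \<beta> (K (f x))" using freq by blast
    show "\<exists>y. (1 \<le> y \<and> \<epsilon> \<le> zygmund_norm \<beta> (K (f y))) \<and> 2 * x \<le> y"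
      if "1 \<le> x \<and> \<epsilon> \<le> zygmund_norm \<beta> (K (f x))" for x :: nat and n :: nat
      using freq[of "2 * x"] that by (meson le_trans nat_le_linear not_less_eq_eq mult_2 trans_le_add1)
  qed
  then obtain s where s1: "\<And>k. 1 \<le> s k" and se: "\<And>k. \<epsilon> \<le> zygmund_norm \<beta> (K (f (s k)))"
    and s2: "\<And>k. 2 * s k \<le> s (Suc k)" by blast
  have growth: "2 * s i \<le> s j" if "i < j" for i j
    using that
  proof (induction j)
    case (Suc j)
    then show ?case using s2[of j] by (cases "i = j") auto
  qed simp
  obtain r g where r: "strict_mono r" and g: "g \<in> zygmund_space \<beta>"
    and lim: "(\<lambda>n. zygmund_norm \<beta> (\<lambda>z. K (f (s (r n))) z - g z)) \<longlonglongrightarrow> 0"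
    using K fX s1 unfolding compact_op_def by (elim conjE allE[of _ "\<lambda>k. f (s k)"]) auto
  have "eventually (\<lambda>n. zygmund_norm \<beta> (\<lambda>z. K (f (s (r n))) z - g z) < \<epsilon> / 4) sequentially"
    using lim by (rule order_tendstoD) (use e in simp)
  then obtain k0 where k0: "\<And>n. k0 \<le> n \<Longrightarrow> zygmund_norm \<beta> (\<lambda>z. K (f (s (r n))) z - g z) < \<epsilon> / 4"
    by (auto simp: eventually_sequentially)
  \<comment> \<open>A subsequence of a lacunary sequence is lacunary again, so discarding the first
    \<open>k0\<close> members leaves degrees to which \<open>sums\<close> applies and whose images
    all lie within \<epsilon>/4 of \<open>g\<close>.\<close>
  define q where "q = (\<lambda>k. s (r (k0 + k)))"
  have q1: "1 \<le> q k" and q2: "2 * q k \<le> q (Suc k)" for k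
    using s1 growth strict_monoD[OF r, of "k0 + k" "Suc (k0 + k)"] by (auto simp: q_def)
  have qX: "f (q k) \<in> X" for k using fX q1 by blast
  have close: "zygmund_norm \<beta> (\<lambda>z. K (f (q k)) z - g z) < \<epsilon> / 4" for k
    using k0[of "k0 + k"] by (simp add: q_def)
  have low: "3 * \<epsilon> / 4 \<le> zygmund_norm \<beta> g"
    using zygmund_norm_triangle_sub[OF KY[OF qX] g, of 0] close[of 0] se[of "r k0"]
    by (simp add: q_def)
  \<comment> \<open>\<open>g\<close> is the average of the images minus the average of the errors.
    By linearity the former is 1/N times the image of a unit ball element; the latter has norm at
    most \<epsilon>/4.\<close>
  have "zygmund_norm \<beta> g \<le> B / real N + \<epsilon> / 4" if N: "1 \<le> N" for N
  proof -
    let ?F = "\<lambda>z. \<Sum>k<N. f (q k) z" and ?D = "\<lambda>z. \<Sum>k<N. K (f (q k)) z - g z"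
    let ?c = "complex_of_real (1 / real N)"
    have FX: "(\<lambda>z. \<Sum>k<N. f (q k) z) \<in> X" for N using sums q1 q2 by blast
    have D: "?D \<in> zygmund_space \<beta>"
      "zygmund_norm \<beta> ?D \<le> (\<Sum>k<N. zygmund_norm \<beta> (\<lambda>z. K (f (q k)) z - g z))"
      using zygmund_sum[of "\<lambda>k z. K (f (q k)) z - g z" \<beta> N, OF zygmund_diff(1)[OF KY[OF qX] g]]
      by auto
    have "(\<Sum>k<N. zygmund_norm \<beta> (\<lambda>z. K (f (q k)) z - g z)) \<le> real N * (\<epsilon> / 4)"
      using sum_bounded_above[of "{..<N}" "\<lambda>k. zygmund_norm \<beta> (\<lambda>z. K (f (q k)) z - g z)" "\<epsilon> / 4"]
        close by (simp add: less_imp_le)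
    with D(2) have D': "zygmund_norm \<beta> ?D \<le> real N * (\<epsilon> / 4)" by linarith
    have "g z = ?c * K ?F z + (- ?c) * ?D z" if z: "z \<in> disc" for z
      using N unfolding linear_op_sum[OF lin qX FX z] by (simp add: sum_subtractf field_simps)
    then have "zygmund_norm \<beta> g = zygmund_norm \<beta> (\<lambda>z. ?c * K ?F z + (- ?c) * ?D z)"
      by (rule zygmund_norm_cong)
    also have "\<dots> \<le> cmod ?c * zygmund_norm \<beta> (K ?F) + cmod (- ?c) * zygmund_norm \<beta> ?D"
      by (rule zygmund_lincomb(2)[OF KY[OF FX] D(1)])
    also have "\<dots> = (zygmund_norm \<beta> (K ?F) + zygmund_norm \<beta> ?D) / real N"
      by (simp add: norm_divide add_divide_distrib)
    also have "\<dots> \<le> (B + real N * (\<epsilon> / 4)) / real N"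
      using D' B[OF FX] sums[of q N] q1 q2 by (intro divide_right_mono add_mono) auto
    also have "\<dots> = B / real N + \<epsilon> / 4" using N by (simp add: field_simps)
    finally show ?thesis .
  qed
  note avg = this
  have "eventually (\<lambda>N. B / real N < \<epsilon> / 4) sequentially"
    by (rule order_tendstoD(2)[OF lim_const_over_n]) (use e in simp)
  then obtain N0 where "\<And>N. N0 \<le> N \<Longrightarrow> B / real N < \<epsilon> / 4"
    by (auto simp: eventually_sequentially)
  \<comment> \<open>Now \<open>g\<close> has norm below \<epsilon>/2, against the lower bound
    3\<epsilon>/4 in \<open>low\<close>.\<close>
  from this[of "max 1 N0"] have "B / real (max 1 N0) < \<epsilon> / 4" by simp
  with low avg[of "max 1 N0"] e show False by linarith
qed

section \<open>The lower bound\<close>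

lemma norm_diff3_le:
  fixes x y z :: "'a :: real_normed_vector"
  shows "norm (x - y - z) \<le> norm x + norm y + norm z"
  using norm_triangle_ineq4[of "x - y" z] norm_triangle_ineq4[of x y] by linarith

text \<open>With \<open>\<tau> = a ^ n\<close>, the bracket at \<open>m = k * n\<close> is
  \<open>X k = \<tau> ^ k * (P + k * Q + k * (k * n - 1) * R)\<close> for \<open>k = 1, 2, 3\<close>; second differences
  in \<open>k\<close> isolate \<open>R\<close>, then first differences isolate \<open>Q\<close>.\<close>
lemma monomial_elimination:
  fixes A0 A1 A2 a :: complex and w N \<alpha> :: real and n :: nat
  assumes \<alpha>: "1 \<le> \<alpha>" and n: "1 \<le> n" and w: "0 \<le> w" and a: "cmod a \<le> 1"
    and hyp: "\<And>m. n \<le> m \<Longrightarrow> real m powr (\<alpha> - 1) * (w * cmod (A0 * a ^ m + A1 * (of_nat m * a ^ (m - 1))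
       + A2 * (of_nat m * (of_nat (m - 1) * a ^ (m - 2))))) \<le> N"
  shows "real n powr (\<alpha> - 1) * (w * (cmod A0 * cmod a ^ (3 * n))) \<le> 11 * N"
    and "real n powr \<alpha> * (w * (cmod A1 * cmod a ^ (3 * n))) \<le> 11 * N"
    and "real n powr (\<alpha> + 1) * (w * (cmod A2 * cmod a ^ (3 * n))) \<le> 11 * N"
proof -
  have N: "0 \<le> N" using order_trans[OF _ hyp[of n]] w by simp
  have "real n powr (\<alpha> - 1) * (w * (cmod A0 * cmod a ^ (3 * n))) \<le> 11 * N \<and>
    real n powr \<alpha> * (w * (cmod A1 * cmod a ^ (3 * n))) \<le> 11 * N \<and>
    real n powr (\<alpha> + 1) * (w * (cmod A2 * cmod a ^ (3 * n))) \<le> 11 * N"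
  proof (cases "a = 0")
    case True
    then show ?thesis using n N by (simp add: power_0_left)
  next
    case False
    define \<tau> where "\<tau> = a ^ n"
    define P where "P = A0"
    define Q where "Q = A1 * of_nat n / a"
    define R where "R = A2 * of_nat n / a ^ 2"
    define v where "v = w * real n powr (\<alpha> - 1)"
    define X where "X = (\<lambda>k::nat. \<tau> ^ k * (P + of_nat k * Q + of_nat k * (of_nat k * of_nat n - 1) * R))"
    have v0: "0 \<le> v" using w by (simp add: v_def)
    have X: "v * cmod (X k) \<le> N" if k: "1 \<le> k" for k
    proof -
      let ?m = "k * n"
      have m: "1 \<le> ?m" "n \<le> ?m" using n k by auto
      have e1: "a ^ (?m - 1) = \<tau> ^ k / a"
        using False m(1) by (simp add: \<tau>_def power_diff flip: power_mult add: mult.commute)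
      \<comment> \<open>At degree 1 the exponent m - 2 is truncated to 0, but the coefficient m - 1
        vanishes, so the identity survives.\<close>
      have e2: "of_nat (?m - 1) * a ^ (?m - 2) = of_nat (?m - 1) * (\<tau> ^ k / a ^ 2)"
      proof (cases "?m = 1")
        case False
        then have "2 \<le> ?m" using m(1) by linarith
        then show ?thesis
          using \<open>a \<noteq> 0\<close> by (simp add: \<tau>_def power_diff flip: power_mult add: mult.commute)
      qed simp
      have "A0 * a ^ ?m + A1 * (of_nat ?m * a ^ (?m - 1))
          + A2 * (of_nat ?m * (of_nat (?m - 1) * a ^ (?m - 2))) = X k"
        unfolding e1 e2 X_def using m(1) False
        by (simp add: P_def Q_def R_def \<tau>_def of_nat_diff field_simps flip: power_mult)
      then have "real ?m powr (\<alpha> - 1) * (w * cmod (X k)) \<le> N"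
        using hyp[OF m(2)] by simp
      moreover have "real n powr (\<alpha> - 1) \<le> real ?m powr (\<alpha> - 1)"
        using \<alpha> m by (intro powr_mono2) auto
      ultimately show ?thesis
        using w by (smt (verit) v_def mult.assoc mult.commute mult_right_mono mult_nonneg_nonneg norm_ge_zero)
    qed
    have t1: "cmod \<tau> \<le> 1" using a by (simp add: \<tau>_def norm_power power_le_one)
    have tX: "v * cmod (\<tau> ^ i * X k) \<le> N" if "1 \<le> k" for i k
    proof -
      have "cmod (\<tau> ^ i * X k) \<le> cmod (X k)"
        using t1 by (simp add: norm_mult norm_power mult_left_le_one_le power_le_one)
      then show ?thesis using X[OF that] v0 by (meson mult_left_mono order_trans)
    qed
    \<comment> \<open>The second difference of k (k n - 1) is 2 n, and P and Q drop out. The powers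
      of \<tau> bring all terms to \<tau>^3, and 4 = 1 + 2 + 1 counts the values of
      \<open>X\<close>.\<close>
    have R: "v * (2 * real n * cmod (\<tau> ^ 3 * R)) \<le> 4 * N"
    proof -
      have "2 * of_nat n * (\<tau> ^ 3 * R) = \<tau> ^ 0 * X 3 - \<tau> ^ 1 * X 2 - \<tau> ^ 1 * X 2 + \<tau> ^ 2 * X 1"
        by (simp add: X_def power3_eq_cube power2_eq_square algebra_simps)
      then have "2 * real n * cmod (\<tau> ^ 3 * R)
          = cmod (\<tau> ^ 0 * X 3 - \<tau> ^ 1 * X 2 - \<tau> ^ 1 * X 2 + \<tau> ^ 2 * X 1)"
        by (metis norm_mult norm_of_nat norm_numeral)
      also have "\<dots> \<le> cmod (\<tau> ^ 0 * X 3) + cmod (\<tau> ^ 1 * X 2) + cmod (\<tau> ^ 1 * X 2) + cmod (\<tau> ^ 2 * X 1)"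
        using norm_triangle_ineq[of "\<tau> ^ 0 * X 3 - \<tau> ^ 1 * X 2 - \<tau> ^ 1 * X 2" "\<tau> ^ 2 * X 1"]
          norm_diff3_le[of "\<tau> ^ 0 * X 3" "\<tau> ^ 1 * X 2" "\<tau> ^ 1 * X 2"] by linarith
      finally have "v * (2 * real n * cmod (\<tau> ^ 3 * R)) \<le>
        v * (cmod (\<tau> ^ 0 * X 3) + cmod (\<tau> ^ 1 * X 2) + cmod (\<tau> ^ 1 * X 2) + cmod (\<tau> ^ 2 * X 1))"
        using v0 by (rule mult_left_mono)
      then show ?thesis
        using tX[of 3 0] tX[of 2 1] tX[of 1 2] by (simp only: distrib_left) linarith
    qed
    \<comment> \<open>The first difference from k = 1 to k = 2 is Q + (3 n - 1) R. The R term costs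
      at most 3/2 times 4 N, so the total is N + N + 6 N.\<close>
    have Q: "v * cmod (\<tau> ^ 3 * Q) \<le> 8 * N"
    proof -
      have "\<tau> ^ 3 * Q = \<tau> ^ 1 * X 2 - \<tau> ^ 2 * X 1 - (3 * of_nat n - 1) * (\<tau> ^ 3 * R)"
        by (simp add: X_def power3_eq_cube power2_eq_square algebra_simps)
      then have "cmod (\<tau> ^ 3 * Q)
          \<le> cmod (\<tau> ^ 1 * X 2) + cmod (\<tau> ^ 2 * X 1) + cmod ((3 * of_nat n - 1) * (\<tau> ^ 3 * R))"
        by (simp only: norm_diff3_le)
      also have "cmod ((3 * of_nat n - 1) * (\<tau> ^ 3 * R)) \<le> (3 * real n) * cmod (\<tau> ^ 3 * R)"
      proof -
        have "3 * of_nat n - 1 = complex_of_real (3 * real n - 1)" by simp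
        then have "cmod (3 * of_nat n - 1) = \<bar>3 * real n - 1\<bar>" by (metis norm_of_real)
        also have "\<dots> \<le> 3 * real n" using n by simp
        finally show ?thesis unfolding norm_mult by (rule mult_right_mono) simp
      qed
      finally have "v * cmod (\<tau> ^ 3 * Q) \<le>
        v * (cmod (\<tau> ^ 1 * X 2) + cmod (\<tau> ^ 2 * X 1) + (3 * real n) * cmod (\<tau> ^ 3 * R))"
        using v0 by (simp add: mult_left_mono)
      then show ?thesis
        using tX[of 2 1] tX[of 1 2] R by (simp add: distrib_left algebra_simps)
    qed
    \<comment> \<open>At k = 1 the bracket is P + Q + (n - 1) R; the total is N + 8 N + 2 N, which
      is where 11 comes from.\<close>
    have P: "v * cmod (\<tau> ^ 3 * P) \<le> 11 * N"
    proof -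
      have "\<tau> ^ 3 * P = \<tau> ^ 2 * X 1 - \<tau> ^ 3 * Q - (of_nat n - 1) * (\<tau> ^ 3 * R)"
        by (simp add: X_def power3_eq_cube power2_eq_square algebra_simps)
      then have "cmod (\<tau> ^ 3 * P)
          \<le> cmod (\<tau> ^ 2 * X 1) + cmod (\<tau> ^ 3 * Q) + cmod ((of_nat n - 1) * (\<tau> ^ 3 * R))"
        by (simp only: norm_diff3_le)
      also have "cmod ((of_nat n - 1) * (\<tau> ^ 3 * R)) \<le> real n * cmod (\<tau> ^ 3 * R)"
      proof -
        have "of_nat n - 1 = complex_of_real (real n - 1)" by simp
        then have "cmod (of_nat n - 1) = \<bar>real n - 1\<bar>" by (metis norm_of_real)
        also have "\<dots> \<le> real n" using n by simp
        finally show ?thesis unfolding norm_mult by (rule mult_right_mono) simp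
      qed
      finally have "v * cmod (\<tau> ^ 3 * P) \<le>
        v * (cmod (\<tau> ^ 2 * X 1) + cmod (\<tau> ^ 3 * Q) + real n * cmod (\<tau> ^ 3 * R))"
        using v0 by (simp add: mult_left_mono)
      then show ?thesis
        using tX[of 1 2] Q R by (simp add: distrib_left algebra_simps)
    qed
    have tau3: "cmod (\<tau> ^ 3) = cmod a ^ (3 * n)"
      by (simp add: \<tau>_def norm_power mult.commute flip: power_mult)
    have ia: "1 \<le> inverse (cmod a)" using False a by (simp add: one_le_inverse)
    have A1: "cmod Q = real n * (cmod A1 * inverse (cmod a))"
      by (simp add: Q_def norm_mult norm_divide field_simps)
    have A2: "cmod R = real n * (cmod A2 * inverse (cmod a) ^ 2)"
      by (simp add: R_def norm_mult norm_divide norm_power field_simps)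
    \<comment> \<open>The extra powers of n are those hidden in the unknowns: Q carries one factor
      n, and R carries one besides the n already present in its bound.\<close>
    have p0: "real n powr \<alpha> = real n powr (\<alpha> - 1) * real n"
      and p1: "real n powr (\<alpha> + 1) = real n powr (\<alpha> - 1) * (real n * real n)"
      using n by (simp_all add: powr_diff powr_add)
    have "real n powr (\<alpha> - 1) * (w * (cmod A0 * cmod a ^ (3 * n))) \<le> 11 * N"
      using P unfolding norm_mult tau3 by (simp add: P_def v_def mult_ac)
    moreover have "real n powr \<alpha> * (w * (cmod A1 * cmod a ^ (3 * n))) \<le> 11 * N"
    proof -
      have "v * (cmod a ^ (3 * n) * (real n * (cmod A1 * 1))) \<le> v * cmod (\<tau> ^ 3 * Q)"
        unfolding norm_mult tau3 A1 by (intro mult_left_mono ia) (use v0 in auto)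
      then show ?thesis using Q N unfolding p0 v_def by (simp add: mult_ac)
    qed
    moreover have "real n powr (\<alpha> + 1) * (w * (cmod A2 * cmod a ^ (3 * n))) \<le> 11 * N"
    proof -
      have "v * (real n * (cmod a ^ (3 * n) * (real n * (cmod A2 * 1)))) \<le> v * (real n * cmod (\<tau> ^ 3 * R))"
        unfolding norm_mult tau3 A2 by (intro mult_left_mono one_le_power ia) (use v0 in auto)
      then show ?thesis using R N unfolding p1 v_def by (simp add: mult_ac)
    qed
    ultimately show ?thesis by blast
  qed
  then show "real n powr (\<alpha> - 1) * (w * (cmod A0 * cmod a ^ (3 * n))) \<le> 11 * N"
    and "real n powr \<alpha> * (w * (cmod A1 * cmod a ^ (3 * n))) \<le> 11 * N"
    and "real n powr (\<alpha> + 1) * (w * (cmod A2 * cmod a ^ (3 * n))) \<le> 11 * N" by blast+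
qed

text \<open>With k = n div 3, 3 k \<le> n makes b^n at most b^(3k), and n + 1 \<le> 3 k + 3 \<le> 6
  k because k \<ge> 1. The common exponent \<open>p\<close> serves the three values of
  \<open>s\<close> with a single constant.\<close>

lemma powr_shift_third:
  fixes s p w A b N :: real
  assumes s: "0 \<le> s" "s \<le> p" and M: "1 \<le> M" and n: "3 * M \<le> n" and b: "0 \<le> b" "b \<le> 1"
    and w: "0 \<le> w" "0 \<le> A"
    and hyp: "\<And>k. M \<le> k \<Longrightarrow> real k powr s * (w * (A * b ^ (3 * k))) \<le> N"
  shows "real (n + 1) powr s * (w * (A * b ^ n)) \<le> 6 powr p * N"
proof -
  define k where "k = n div 3"
  have "3 * k \<le> n" "n < 3 * k + 3" unfolding k_def by presburger+
  then have k: "M \<le> k" "3 * k \<le> n" and "n + 1 \<le> 3 * k + 3" using n M by linarith+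
  then have k6: "n + 1 \<le> 6 * k" using M by linarith
  have N: "0 \<le> N" using order_trans[OF _ hyp[OF order_refl]] w b by simp
  have "real (n + 1) powr s \<le> (6 * real k) powr s"
    using k6 s by (intro powr_mono2) linarith+
  also have "\<dots> = 6 powr s * real k powr s" by (simp add: powr_mult)
  finally have 1: "real (n + 1) powr s \<le> 6 powr s * real k powr s" .
  have "b ^ n \<le> b ^ (3 * k)" using b k(2) by (rule power_decreasing[rotated])
  then have 2: "w * (A * b ^ n) \<le> w * (A * b ^ (3 * k))" using w by (intro mult_left_mono)
  have "real (n + 1) powr s * (w * (A * b ^ n)) \<le> (6 powr s * real k powr s) * (w * (A * b ^ (3 * k)))"
    by (rule mult_mono[OF 1 2]) (use w b in auto)
  also have "\<dots> \<le> 6 powr s * N" using hyp[OF k(1)] by (simp add: mult.assoc)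
  also have "\<dots> \<le> 6 powr p * N" using s N by (intro mult_right_mono powr_mono) auto
  finally show ?thesis .
qed

section \<open>Passage between pointwise bounds, extended-real norms and the real operator
  norm\<close>

lemma nu_norm_mult_le:
  assumes "0 < c" "\<And>z. z \<in> disc \<Longrightarrow> c * (wt \<beta> z * cmod (g z)) \<le> B"
  shows "ereal c * nu_norm \<beta> g \<le> ereal B"
proof -
  have "nu_norm \<beta> g \<le> ereal (B / c)"
    unfolding nu_norm_def using assms by (intro SUP_least) (simp add: field_simps)
  then have "ereal c * nu_norm \<beta> g \<le> ereal c * ereal (B / c)"
    using assms(1) by (intro ereal_mult_left_mono) auto
  then show ?thesis using assms(1) by simp
qed

lemma nu_norm_mult_leD:
  assumes "0 \<le> c" "ereal c * nu_norm \<beta> g \<le> ereal B" "z \<in> disc"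
  shows "c * (wt \<beta> z * cmod (g z)) \<le> B"
proof -
  have "ereal (wt \<beta> z * cmod (g z)) \<le> nu_norm \<beta> g"
    unfolding nu_norm_def by (rule SUP_upper[OF assms(3)])
  then have "ereal c * ereal (wt \<beta> z * cmod (g z)) \<le> ereal c * nu_norm \<beta> g"
    using assms(1) by (intro ereal_mult_left_mono) auto
  from order_trans[OF this assms(2)] show ?thesis by simp
qed

text \<open>The real supremum in \<open>op_norm\<close> dominates its members only when they are
  bounded above. Boundedness of \<open>T\<close> and of the compact \<open>K\<close> provides the
  bound |M| + B; the absolute value is there because the sign of M is unknown.\<close>

lemma op_norm_upper:
  assumes T: "bounded_op X nX (zygmund_space \<beta>) (zygmund_norm \<beta>) T"
    and K: "compact_op X nX (zygmund_space \<beta>) (zygmund_norm \<beta>) K"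
    and nX: "\<And>f. f \<in> X \<Longrightarrow> 0 \<le> nX f"
    and f: "f \<in> X" "nX f \<le> 1"
  shows "zygmund_norm \<beta> (\<lambda>z. T f z - K f z)
    \<le> op_norm X nX (zygmund_norm \<beta>) (\<lambda>f z. T f z - K f z)"
proof -
  obtain M where M: "\<And>f. f \<in> X \<Longrightarrow> zygmund_norm \<beta> (T f) \<le> M * nX f"
    using T unfolding bounded_op_def by blast
  obtain B where B: "\<And>f. f \<in> X \<Longrightarrow> nX f \<le> 1 \<Longrightarrow> zygmund_norm \<beta> (K f) \<le> B"
    using compact_op_bounded[OF K] by blast
  have "zygmund_norm \<beta> (\<lambda>z. T h z - K h z) \<le> \<bar>M\<bar> + B" if h: "h \<in> X" "nX h \<le> 1" for h
  proof -
    have "zygmund_norm \<beta> (\<lambda>z. T h z - K h z) \<le> zygmund_norm \<beta> (T h) + zygmund_norm \<beta> (K h)"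
      using T K h unfolding bounded_op_def compact_op_def linear_op_def
      by (intro zygmund_diff(2)) auto
    also have "\<dots> \<le> M * nX h + B" using M B h by (intro add_mono) auto
    also have "M * nX h \<le> \<bar>M\<bar> * 1" using nX h by (intro mult_mono) auto
    finally show ?thesis by simp
  qed
  then show ?thesis
    unfolding op_norm_def using f by (intro cSUP_upper) (auto intro!: bdd_aboveI2)
qed

lemma bloch_norm_nonneg:
  assumes "f \<in> bloch_space \<alpha>"
  shows "0 \<le> bloch_norm \<alpha> f"
proof -
  have "wt \<alpha> 0 * cmod (deriv f 0) \<le> (SUP z\<in>disc. wt \<alpha> z * cmod (deriv f z))"
    using assms by (intro cSUP_upper) (auto simp: bloch_space_def)
  from order_trans[OF _ this] show ?thesis by (simp add: bloch_norm_def)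
qed

text \<open>The estimate is for each compact \<open>K\<close> separately, with \<open>C\<close>
  chosen from \<alpha> before everything else, so that the infimum over \<open>K\<close> can be
  taken afterwards.\<close>

lemma essential_norm_lower:
  assumes \<alpha>: "1 < \<alpha>"
  obtains C :: real where "0 < C"
    "\<And>\<beta> u \<phi> K. \<lbrakk>u holomorphic_on disc; \<phi> holomorphic_on disc; \<phi> ` disc \<subseteq> disc;
      bounded_op (bloch_space \<alpha>) (bloch_norm \<alpha>) (zygmund_space \<beta>) (zygmund_norm \<beta>) (wcomp u \<phi>);
      compact_op (bloch_space \<alpha>) (bloch_norm \<alpha>) (zygmund_space \<beta>) (zygmund_norm \<beta>) K\<rbrakk> \<Longrightarrow>
      max (limsup (\<lambda>n. ereal (real (n+1) powr \<alpha>) *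
             nu_norm \<beta> (\<lambda>z. (2 * deriv u z * deriv \<phi> z + u z * deriv (deriv \<phi>) z) * (\<phi> z)^n)))
        (max (limsup (\<lambda>n. ereal (real (n+1) powr (\<alpha>+1)) *
               nu_norm \<beta> (\<lambda>z. u z * (deriv \<phi> z)^2 * (\<phi> z)^n)))
             (limsup (\<lambda>n. ereal (real (n+1) powr (\<alpha>-1)) *
               nu_norm \<beta> (\<lambda>z. deriv (deriv u) z * (\<phi> z)^n))))
      \<le> ereal (C * op_norm (bloch_space \<alpha>) (bloch_norm \<alpha>) (zygmund_norm \<beta>) (\<lambda>f z. wcomp u \<phi> f z - K f z))"
proof -
  obtain c :: real where c: "0 < c" and mono:
    "\<And>(q :: nat \<Rightarrow> nat) N. \<lbrakk>\<And>k. 1 \<le> q k; \<And>k. 2 * q k \<le> q (Suc k)\<rbrakk> \<Longrightarrow>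
      (\<lambda>z. \<Sum>k<N. of_real (c * real (q k) powr (\<alpha> - 1)) * z ^ q k) \<in> bloch_space \<alpha> \<and>
      bloch_norm \<alpha> (\<lambda>z. \<Sum>k<N. of_real (c * real (q k) powr (\<alpha> - 1)) * z ^ q k) \<le> 1"
    by (rule lacunary_monomials[OF less_imp_le[OF \<alpha>]]) (rule that; blast)
  \<comment> \<open>Elimination contributes 11, the return from 3 k to n contributes 6^(\<alpha>+1),
    and 1/c undoes the normalisation of the monomials.\<close>
  define C where "C = 6 powr (\<alpha> + 1) * 11 / c"
  have C: "0 < C" using c by (simp add: C_def)
  show ?thesis
  proof (rule that[OF C])
    fix \<beta> u \<phi> K
    assume u: "u holomorphic_on disc" and p: "\<phi> holomorphic_on disc" and pd: "\<phi> ` disc \<subseteq> disc"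
      and T: "bounded_op (bloch_space \<alpha>) (bloch_norm \<alpha>) (zygmund_space \<beta>) (zygmund_norm \<beta>) (wcomp u \<phi>)"
      and K: "compact_op (bloch_space \<alpha>) (bloch_norm \<alpha>) (zygmund_space \<beta>) (zygmund_norm \<beta>) K"
    define L where "L = op_norm (bloch_space \<alpha>) (bloch_norm \<alpha>) (zygmund_norm \<beta>) (\<lambda>f z. wcomp u \<phi> f z - K f z)"
    define A0 where "A0 = deriv (deriv u)"
    define A1 where "A1 = (\<lambda>z. 2 * deriv u z * deriv \<phi> z + u z * deriv (deriv \<phi>) z)"
    define A2 where "A2 = (\<lambda>z. u z * (deriv \<phi> z)^2)"
    define f where "f = (\<lambda>m z. complex_of_real (c * real m powr (\<alpha> - 1)) * z ^ m)"
    have fX: "f m \<in> bloch_space \<alpha>" "bloch_norm \<alpha> (f m) \<le> 1" if "1 \<le> m" for m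
      using mono[of "\<lambda>k. m * 2 ^ k" 1] that by (simp_all add: f_def)
    have TY: "wcomp u \<phi> h \<in> zygmund_space \<beta>" and KY: "K h \<in> zygmund_space \<beta>"
      if "h \<in> bloch_space \<alpha>" for h
      using T K that by (simp_all add: bounded_op_def compact_op_def linear_op_def)
    have ev: "eventually (\<lambda>n. (\<forall>z\<in>disc.
          real (n + 1) powr (\<alpha> - 1) * (wt \<beta> z * cmod (A0 z * (\<phi> z) ^ n)) \<le> C * L + d \<and>
          real (n + 1) powr \<alpha> * (wt \<beta> z * cmod (A1 z * (\<phi> z) ^ n)) \<le> C * L + d \<and>
          real (n + 1) powr (\<alpha> + 1) * (wt \<beta> z * cmod (A2 z * (\<phi> z) ^ n)) \<le> C * L + d)) sequentially"
      if d: "0 < d" for d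
    proof -
      \<comment> \<open>Chosen so that C (L + e) = C L + d.\<close>
      define e where "e = d / C"
      have e: "0 < e" using d C by (simp add: e_def)
      have "eventually (\<lambda>m. zygmund_norm \<beta> (K (f m)) < e) sequentially"
        by (rule compact_op_lacunary_tendsto_0[OF K _ e]) (use mono in \<open>simp add: f_def\<close>)
      then obtain M0 where M0: "\<And>m. M0 \<le> m \<Longrightarrow> zygmund_norm \<beta> (K (f m)) < e"
        by (auto simp: eventually_sequentially)
      define M where "M = max 1 M0"
      have M: "1 \<le> M" by (simp add: M_def)
      define N where "N = (L + e) / c"
      have key: "real m powr (\<alpha> - 1) * (wt \<beta> z * cmod (A0 z * \<phi> z ^ m + A1 z * (of_nat m * \<phi> z ^ (m - 1))
          + A2 z * (of_nat m * (of_nat (m - 1) * \<phi> z ^ (m - 2))))) \<le> N"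
        if m: "M \<le> m" and z: "z \<in> disc" for m z
      proof -
        have m1: "1 \<le> m" using m M by simp
        have hol: "f m holomorphic_on disc" unfolding f_def by (intro holomorphic_intros)
        have d1: "deriv (f m) = (\<lambda>z. of_real (c * real m powr (\<alpha> - 1)) * (of_nat m * z ^ (m - 1)))"
          unfolding f_def by (intro ext DERIV_imp_deriv) (auto intro!: derivative_eq_intros)
        have d2: "deriv (deriv (f m)) = (\<lambda>z. of_real (c * real m powr (\<alpha> - 1)) *
            (of_nat m * (of_nat (m - 1) * z ^ (m - 2))))"
          unfolding d1 by (intro ext DERIV_imp_deriv)
            (auto intro!: derivative_eq_intros simp: numeral_2_eq_2)
        have dd: "deriv (deriv (wcomp u \<phi> (f m))) z = of_real (c * real m powr (\<alpha> - 1)) *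
            (A0 z * \<phi> z ^ m + A1 z * (of_nat m * \<phi> z ^ (m - 1))
             + A2 z * (of_nat m * (of_nat (m - 1) * \<phi> z ^ (m - 2))))"
          unfolding wcomp_deriv(2)[OF u p pd hol z] d2 unfolding d1
          by (simp add: A0_def A1_def A2_def f_def algebra_simps)
        have "wt \<beta> z * cmod (deriv (deriv (wcomp u \<phi> (f m))) z) \<le> zygmund_norm \<beta> (wcomp u \<phi> (f m))"
          by (rule zygmund_weight_le[OF TY[OF fX(1)[OF m1]] z])
        \<comment> \<open>The image under T splits into that under T - K, at most \<open>L\<close>
          as \<open>f m\<close> is in the unit ball, and that under K, which is small for large
          m.\<close>
        also have "\<dots> \<le> zygmund_norm \<beta> (\<lambda>z. wcomp u \<phi> (f m) z - K (f m) z) + zygmund_norm \<beta> (K (f m))"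
          by (rule zygmund_norm_triangle_sub[OF TY KY]) (use fX m1 in auto)
        also have "\<dots> \<le> L + e"
          using op_norm_upper[OF T K bloch_norm_nonneg fX[OF m1]] M0[of m] m
          unfolding L_def M_def by simp
        finally have "c * (real m powr (\<alpha> - 1) * (wt \<beta> z * cmod (A0 z * \<phi> z ^ m
             + A1 z * (of_nat m * \<phi> z ^ (m - 1))
             + A2 z * (of_nat m * (of_nat (m - 1) * \<phi> z ^ (m - 2)))))) \<le> L + e"
          unfolding dd using c by (simp add: norm_mult mult_ac)
        then show ?thesis using c by (simp add: N_def field_simps)
      qed
      have CN: "6 powr (\<alpha> + 1) * (11 * N) = C * L + d"
        using c C by (simp add: N_def C_def e_def field_simps)
      have "real (n + 1) powr (\<alpha> - 1) * (wt \<beta> z * cmod (A0 z * (\<phi> z) ^ n)) \<le> C * L + d \<and>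
          real (n + 1) powr \<alpha> * (wt \<beta> z * cmod (A1 z * (\<phi> z) ^ n)) \<le> C * L + d \<and>
          real (n + 1) powr (\<alpha> + 1) * (wt \<beta> z * cmod (A2 z * (\<phi> z) ^ n)) \<le> C * L + d"
        if n: "3 * M \<le> n" and z: "z \<in> disc" for n z
      proof -
        have "\<phi> z \<in> disc" using pd z by blast
        then have b: "cmod (\<phi> z) \<le> 1" by (simp add: in_disc)
        have el: "real k powr (\<alpha> - 1) * (wt \<beta> z * (cmod (A0 z) * cmod (\<phi> z) ^ (3 * k))) \<le> 11 * N"
          "real k powr \<alpha> * (wt \<beta> z * (cmod (A1 z) * cmod (\<phi> z) ^ (3 * k))) \<le> 11 * N"
          "real k powr (\<alpha> + 1) * (wt \<beta> z * (cmod (A2 z) * cmod (\<phi> z) ^ (3 * k))) \<le> 11 * N"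
          if k: "M \<le> k" for k
          using monomial_elimination[of \<alpha> k "wt \<beta> z" "\<phi> z" "A0 z" "A1 z" "A2 z" N]
            key[OF _ z] k M \<alpha> b by auto
        show ?thesis
          unfolding norm_mult norm_power CN[symmetric]
          by (intro conjI powr_shift_third[OF _ _ M n])
            (use el b \<alpha> in \<open>auto simp only: norm_ge_zero wt_nonneg\<close>)
      qed
      then show ?thesis unfolding eventually_sequentially by blast
    qed
    have ls: "limsup (\<lambda>n. ereal (real (n+1) powr s) * nu_norm \<beta> (\<lambda>z. A z * (\<phi> z)^n)) \<le> ereal (C * L)"
      if A: "\<And>d. 0 < d \<Longrightarrow> eventually (\<lambda>n. \<forall>z\<in>disc.
        real (n + 1) powr s * (wt \<beta> z * cmod (A z * (\<phi> z) ^ n)) \<le> C * L + d) sequentially" for s A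
    proof (rule ereal_le_epsilon2)
      fix d :: real assume "0 < d"
      have "limsup (\<lambda>n. ereal (real (n+1) powr s) * nu_norm \<beta> (\<lambda>z. A z * (\<phi> z)^n)) \<le> ereal (C * L + d)"
      proof (rule Limsup_bounded)
        show "eventually (\<lambda>n. ereal (real (n+1) powr s) * nu_norm \<beta> (\<lambda>z. A z * (\<phi> z)^n) \<le> ereal (C * L + d)) sequentially"
          using A[OF \<open>0 < d\<close>] by eventually_elim (rule nu_norm_mult_le, auto)
      qed
      then show "limsup (\<lambda>n. ereal (real (n+1) powr s) * nu_norm \<beta> (\<lambda>z. A z * (\<phi> z)^n)) \<le> ereal (C * L) + ereal d"
        by simp
    qed
    have "limsup (\<lambda>n. ereal (real (n+1) powr \<alpha>) * nu_norm \<beta> (\<lambda>z. A1 z * (\<phi> z)^n)) \<le> ereal (C * L)"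
      "limsup (\<lambda>n. ereal (real (n+1) powr (\<alpha>+1)) * nu_norm \<beta> (\<lambda>z. A2 z * (\<phi> z)^n)) \<le> ereal (C * L)"
      "limsup (\<lambda>n. ereal (real (n+1) powr (\<alpha>-1)) * nu_norm \<beta> (\<lambda>z. A0 z * (\<phi> z)^n)) \<le> ereal (C * L)"
      by (rule ls, use ev in \<open>force elim: eventually_mono\<close>)+
    then show "max (limsup (\<lambda>n. ereal (real (n+1) powr \<alpha>) *
             nu_norm \<beta> (\<lambda>z. (2 * deriv u z * deriv \<phi> z + u z * deriv (deriv \<phi>) z) * (\<phi> z)^n)))
        (max (limsup (\<lambda>n. ereal (real (n+1) powr (\<alpha>+1)) *
               nu_norm \<beta> (\<lambda>z. u z * (deriv \<phi> z)^2 * (\<phi> z)^n)))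
             (limsup (\<lambda>n. ereal (real (n+1) powr (\<alpha>-1)) *
               nu_norm \<beta> (\<lambda>z. deriv (deriv u) z * (\<phi> z)^n))))
      \<le> ereal (C * op_norm (bloch_space \<alpha>) (bloch_norm \<alpha>) (zygmund_norm \<beta>) (\<lambda>f z. wcomp u \<phi> f z - K f z))"
      unfolding A0_def A1_def A2_def L_def by simp
  qed
qed

section \<open>Dilated weighted composition operators are compact\<close>

text \<open>Shared by the compactness proof and the upper bound, which differ only in how
  \<open>S\<close> is obtained. The extra summands are the values at 0 of the function and of its
  derivative, which belong to the Zygmund norm.\<close>

lemma wcomp_zygmund_le:
  assumes u: "u holomorphic_on disc" and p: "\<phi> holomorphic_on disc" and pd: "\<phi> ` disc \<subseteq> disc"
    and h: "h holomorphic_on disc"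
    and S: "\<And>z. z \<in> disc \<Longrightarrow> wt \<beta> z * (cmod (deriv (deriv u) z) * cmod (h (\<phi> z))
      + cmod (2 * deriv u z * deriv \<phi> z + u z * deriv (deriv \<phi>) z) * cmod (deriv h (\<phi> z))
      + cmod (u z * (deriv \<phi> z)^2) * cmod (deriv (deriv h) (\<phi> z))) \<le> S"
  shows "wcomp u \<phi> h \<in> zygmund_space \<beta>"
    and "zygmund_norm \<beta> (wcomp u \<phi> h) \<le> cmod (u 0) * cmod (h (\<phi> 0))
      + cmod (deriv u 0) * cmod (h (\<phi> 0)) + cmod (u 0) * cmod (deriv \<phi> 0) * cmod (deriv h (\<phi> 0)) + S"
proof -
  have bd: "wt \<beta> z * cmod (deriv (deriv (wcomp u \<phi> h)) z) \<le> S" if z: "z \<in> disc" for z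
  proof (rule order_trans[OF mult_left_mono S[OF z]])
    show "cmod (deriv (deriv (wcomp u \<phi> h)) z) \<le> cmod (deriv (deriv u) z) * cmod (h (\<phi> z))
      + cmod (2 * deriv u z * deriv \<phi> z + u z * deriv (deriv \<phi>) z) * cmod (deriv h (\<phi> z))
      + cmod (u z * (deriv \<phi> z)^2) * cmod (deriv (deriv h) (\<phi> z))"
      unfolding wcomp_deriv(2)[OF u p pd h z] norm_mult[symmetric]
      by (intro order_trans[OF norm_triangle_ineq] add_mono order_refl norm_triangle_ineq)
  qed simp
  note * = zygmund_normI[OF wcomp_holomorphic[OF u p pd h] bd]
  show "wcomp u \<phi> h \<in> zygmund_space \<beta>" by (rule *(1))
  have "cmod (deriv (wcomp u \<phi> h) 0) \<le>
      cmod (deriv u 0) * cmod (h (\<phi> 0)) + cmod (u 0) * cmod (deriv \<phi> 0) * cmod (deriv h (\<phi> 0))"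
    unfolding wcomp_deriv(1)[OF u p pd h zero_in_disc] norm_mult[symmetric]
    by (rule norm_triangle_ineq)
  moreover have "cmod (wcomp u \<phi> h 0) = cmod (u 0) * cmod (h (\<phi> 0))"
    by (simp add: wcomp_def norm_mult)
  ultimately show "zygmund_norm \<beta> (wcomp u \<phi> h) \<le> cmod (u 0) * cmod (h (\<phi> 0))
      + cmod (deriv u 0) * cmod (h (\<phi> 0)) + cmod (u 0) * cmod (deriv \<phi> 0) * cmod (deriv h (\<phi> 0)) + S"
    using *(2) by linarith
qed

text \<open>Discs of radius (1 - r)/2 about points with |w| \<le> r stay inside |x| \<le> (1 + r)/2,
  so uniform smallness there passes to both derivatives.\<close>

lemma Cauchy_uniform:
  assumes h: "h holomorphic_on disc" and r: "r < 1"
    and bd: "\<And>w. cmod w \<le> (1 + r) / 2 \<Longrightarrow> cmod (h w) \<le> \<epsilon>" and w: "cmod w \<le> r"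
  shows "cmod (deriv h w) \<le> \<epsilon> / ((1 - r) / 2)" "cmod (deriv (deriv h) w) \<le> 2 * \<epsilon> / ((1 - r) / 2)^2"
proof -
  define R where "R = (1 - r) / 2"
  have R: "0 < R" using r by (simp add: R_def)
  have near: "cmod x \<le> (1 + r) / 2" if "cmod (w - x) \<le> R" for x
    using norm_triangle_sub[of x w] that w by (simp add: norm_minus_commute R_def field_simps)
  have sub: "cball w R \<subseteq> disc"
  proof
    fix x assume "x \<in> cball w R"
    then have "cmod x \<le> (1 + r) / 2" using near by (simp add: dist_norm)
    also have "\<dots> < 1" using r by simp
    finally show "x \<in> disc" by (simp add: in_disc)
  qed
  have *: "cmod ((deriv ^^ n) h w) \<le> fact n * \<epsilon> / R ^ n" for n
  proof (rule Cauchy_inequality)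
    show "h holomorphic_on ball w R"
      using h sub by (meson ball_subset_cball holomorphic_on_subset)
    show "continuous_on (cball w R) h"
      using h sub by (meson holomorphic_on_imp_continuous_on holomorphic_on_subset)
    show "0 < R" by fact
    show "cmod (h x) \<le> \<epsilon>" if "cmod (w - x) = R" for x using bd near that by simp
  qed
  show "cmod (deriv h w) \<le> \<epsilon> / ((1 - r) / 2)" using *[of 1] by (simp add: R_def)
  show "cmod (deriv (deriv h) w) \<le> 2 * \<epsilon> / ((1 - r) / 2)^2"
    using *[of 2] by (simp add: R_def numeral_2_eq_2)
qed

text \<open>Since \<psi> maps into |w| \<le> r, the norm of u h(\<psi>) is at most a constant times
  the supremum of |h| on |w| \<le> (1 + r)/2 (\<open>est\<close>). Locally uniform convergence,
  supplied by Montel's theorem, therefore becomes norm convergence of the images.\<close>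

lemma compact_op_wcomp:
  assumes \<alpha>: "1 < \<alpha>"
    and u: "u holomorphic_on disc" and p: "\<psi> holomorphic_on disc"
    and r: "r < 1" and pr: "\<And>z. z \<in> disc \<Longrightarrow> cmod (\<psi> z) \<le> r"
    and B: "\<And>z. z \<in> disc \<Longrightarrow> wt \<beta> z * cmod (deriv (deriv u) z) \<le> B"
      "\<And>z. z \<in> disc \<Longrightarrow> wt \<beta> z * cmod (2 * deriv u z * deriv \<psi> z + u z * deriv (deriv \<psi>) z) \<le> B"
      "\<And>z. z \<in> disc \<Longrightarrow> wt \<beta> z * cmod (u z * (deriv \<psi> z)^2) \<le> B"
  shows "compact_op (bloch_space \<alpha>) (bloch_norm \<alpha>) (zygmund_space \<beta>) (zygmund_norm \<beta>) (wcomp u \<psi>)"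
proof -
  have pd: "\<psi> ` disc \<subseteq> disc"
  proof (rule image_subsetI)
    fix z assume "z \<in> disc"
    from pr[OF this] r show "\<psi> z \<in> disc" by (simp add: in_disc)
  qed
  have B0: "0 \<le> B" using order_trans[OF _ B(1)[OF zero_in_disc]] by simp
  define R where "R = (1 - r) / 2"
  have R: "0 < R" using r by (simp add: R_def)
  define c where "c = cmod (u 0) + cmod (deriv u 0) + cmod (u 0) * cmod (deriv \<psi> 0) / R
      + B * (1 + 1 / R + 2 / R^2)"
  have c: "0 \<le> c" using B0 R by (simp add: c_def)
  have est: "wcomp u \<psi> h \<in> zygmund_space \<beta> \<and> zygmund_norm \<beta> (wcomp u \<psi> h) \<le> c * \<epsilon>"
    if h: "h holomorphic_on disc" and bd: "\<And>w. cmod w \<le> (1 + r) / 2 \<Longrightarrow> cmod (h w) \<le> \<epsilon>" for h \<epsilon>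
  proof -
    have rr: "cmod (\<psi> z) \<le> (1 + r) / 2" if "z \<in> disc" for z using pr[OF that] r by simp
    have b: "cmod (h (\<psi> z)) \<le> \<epsilon>" "cmod (deriv h (\<psi> z)) \<le> \<epsilon> / R"
      "cmod (deriv (deriv h) (\<psi> z)) \<le> 2 * \<epsilon> / R^2" if z: "z \<in> disc" for z
      using bd[OF rr[OF z]] Cauchy_uniform[OF h r bd pr[OF z]] by (auto simp: R_def)
    have \<epsilon>: "0 \<le> \<epsilon>" using order_trans[OF _ b(1)[OF zero_in_disc]] by simp
    have S: "wt \<beta> z * (cmod (deriv (deriv u) z) * cmod (h (\<psi> z))
      + cmod (2 * deriv u z * deriv \<psi> z + u z * deriv (deriv \<psi>) z) * cmod (deriv h (\<psi> z))
      + cmod (u z * (deriv \<psi> z)^2) * cmod (deriv (deriv h) (\<psi> z))) \<le> B * \<epsilon> + B * (\<epsilon> / R) + B * (2 * \<epsilon> / R^2)"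
      if z: "z \<in> disc" for z
      unfolding distrib_left mult.assoc[symmetric]
      by (intro add_mono mult_mono B[OF z] b[OF z] B0 norm_ge_zero)
    note * = wcomp_zygmund_le[OF u p pd h S]
    have "cmod (u 0) * cmod (h (\<psi> 0)) + cmod (deriv u 0) * cmod (h (\<psi> 0))
        + cmod (u 0) * cmod (deriv \<psi> 0) * cmod (deriv h (\<psi> 0))
        \<le> cmod (u 0) * \<epsilon> + cmod (deriv u 0) * \<epsilon> + cmod (u 0) * cmod (deriv \<psi> 0) * (\<epsilon> / R)"
      by (intro add_mono mult_left_mono b[OF zero_in_disc]) auto
    moreover have "cmod (u 0) * \<epsilon> + cmod (deriv u 0) * \<epsilon> + cmod (u 0) * cmod (deriv \<psi> 0) * (\<epsilon> / R)
      + (B * \<epsilon> + B * (\<epsilon> / R) + B * (2 * \<epsilon> / R^2)) = c * \<epsilon>"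
      by (simp add: c_def algebra_simps)
    ultimately show ?thesis using * by auto
  qed
  \<comment> \<open>Stated for every holomorphic h, because it is also applied to the Montel limit,
    about which only holomorphy is established.\<close>
  have mem: "wcomp u \<psi> h \<in> zygmund_space \<beta>" if h: "h holomorphic_on disc" for h
  proof -
    have "cball 0 ((1 + r) / 2) \<subseteq> disc" using r by (auto simp: in_disc)
    then have "compact (h ` cball 0 ((1 + r) / 2))"
      using h by (meson compact_cball compact_continuous_image holomorphic_on_imp_continuous_on
          holomorphic_on_subset)
    then have "bounded (h ` cball 0 ((1 + r) / 2))" by (rule compact_imp_bounded)
    then obtain G where G: "\<forall>x\<in>cball 0 ((1 + r) / 2). cmod (h x) \<le> G"
      unfolding bounded_iff by blast
    have "cmod (h w) \<le> G" if "cmod w \<le> (1 + r) / 2" for w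
      using G that by (metis mem_cball_0)
    from est[OF h this] show ?thesis by blast
  qed
  have "linear_op (bloch_space \<alpha>) (zygmund_space \<beta>) (wcomp u \<psi>)"
    using mem bloch_holomorphic by (auto simp: linear_op_def wcomp_def algebra_simps)
  moreover have "\<exists>s g. strict_mono s \<and> g \<in> zygmund_space \<beta> \<and>
      (\<lambda>n. zygmund_norm \<beta> (\<lambda>z. wcomp u \<psi> (f (s n)) z - g z)) \<longlonglongrightarrow> 0"
    if f: "\<forall>n. f n \<in> bloch_space \<alpha> \<and> bloch_norm \<alpha> (f n) \<le> 1" for f :: "nat \<Rightarrow> complex \<Rightarrow> complex"
  proof -
    \<comment> \<open>Local boundedness is the growth estimate: its right-hand side is continuous in
      w on the open disc, hence bounded on compact subsets.\<close>
    have bdd: "\<exists>M. \<forall>h\<in>range f. \<forall>z\<in>K. norm (h z) \<le> M" if K: "compact K" "K \<subseteq> disc" for K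
    proof -
      have "continuous_on K (\<lambda>w. (1 + 1 / (\<alpha> - 1)) * (1 - cmod w) powr (-(\<alpha> - 1)))"
        using K(2) by (intro continuous_intros) (auto simp: in_disc)
      then have "bounded ((\<lambda>w. (1 + 1 / (\<alpha> - 1)) * (1 - cmod w) powr (-(\<alpha> - 1))) ` K)"
        using K(1) by (intro compact_imp_bounded compact_continuous_image)
      then obtain M where M: "\<And>w. w \<in> K \<Longrightarrow> \<bar>(1 + 1 / (\<alpha> - 1)) * (1 - cmod w) powr (-(\<alpha> - 1))\<bar> \<le> M"
        unfolding bounded_iff by auto
      have "cmod (f n w) \<le> M" if "w \<in> K" for n w
        using bloch_growth[of "f n" \<alpha> w] f \<alpha> K(2) that M[OF that] by (meson abs_ge_self order_trans subsetD)
      then show ?thesis by blast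
    qed
    have hol: "h holomorphic_on disc" if "h \<in> range f" for h
      using that f bloch_holomorphic by blast
    obtain g s where g: "g holomorphic_on disc" and s: "strict_mono s"
      and ul: "\<And>K. compact K \<Longrightarrow> K \<subseteq> disc \<Longrightarrow> uniform_limit K (f \<circ> s) g sequentially"
      by (rule Montel[OF open_disc hol bdd subset_refl]) (assumption | rule that)+
    have "(\<lambda>n. zygmund_norm \<beta> (\<lambda>z. wcomp u \<psi> (f (s n)) z - wcomp u \<psi> g z)) \<longlonglongrightarrow> 0"
    proof (rule tendstoI)
      fix e :: real assume e: "0 < e"
      \<comment> \<open>The denominator c + 1 stays positive even if c = 0 and gives c times
        \<epsilon> strictly below e.\<close>
      define \<epsilon> where "\<epsilon> = e / (c + 1)"
      have \<epsilon>: "0 < \<epsilon>" using e c by (simp add: \<epsilon>_def)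
      have ce: "c * \<epsilon> < e" using e c by (simp add: \<epsilon>_def field_simps)
      have "cball 0 ((1 + r) / 2) \<subseteq> disc" using r by (auto simp: in_disc)
      then have "eventually (\<lambda>n. \<forall>w\<in>cball 0 ((1 + r) / 2). dist ((f \<circ> s) n w) (g w) < \<epsilon>) sequentially"
        using uniform_limitD[OF ul \<epsilon>] by simp
      then show "eventually (\<lambda>n. dist (zygmund_norm \<beta>
          (\<lambda>z. wcomp u \<psi> (f (s n)) z - wcomp u \<psi> g z)) 0 < e) sequentially"
      proof eventually_elim
        case (elim n)
        define h where "h = (\<lambda>w. f (s n) w - g w)"
        have eq: "(\<lambda>z. wcomp u \<psi> (f (s n)) z - wcomp u \<psi> g z) = wcomp u \<psi> h"
          by (simp add: wcomp_def h_def algebra_simps)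
        have hh: "h holomorphic_on disc"
          unfolding h_def using f g bloch_holomorphic by (intro holomorphic_on_diff) auto
        have "cmod (h w) \<le> \<epsilon>" if "cmod w \<le> (1 + r) / 2" for w
          using elim that by (auto simp: h_def dist_norm less_imp_le)
        from est[OF hh this] zygmund_norm_nonneg[OF mem[OF hh]] ce
        show ?case unfolding eq by (simp add: dist_norm)
      qed
    qed
    then show ?thesis using s mem[OF g] by blast
  qed
  ultimately show ?thesis unfolding compact_op_def by blast
qed

text \<open>For this n, n (1 - b) \<le> 1/2, so Bernoulli's inequality gives b^n \<ge> 1/2, while n
  + 1 is at least 1/(2 (1 - b)). The factor 2 pays for b^n, and 2^s for the 2 in the
  denominator.\<close>

lemma powr_le_power:
  fixes b s :: real
  assumes b: "0 \<le> b" "b < 1" and s: "0 \<le> s"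
  defines "n \<equiv> nat \<lfloor>1 / (2 * (1 - b))\<rfloor>"
  shows "(1 - b) powr (-s) \<le> 2 * 2 powr s * (real (n + 1) powr s * b ^ n)"
proof -
  have p: "0 < 1 / (2 * (1 - b))" using b by simp
  have n1: "real n \<le> 1 / (2 * (1 - b))" using p by (simp add: n_def)
  have n2: "1 / (2 * (1 - b)) \<le> real (n + 1)" unfolding n_def by linarith
  have "1 + real n * (b - 1) \<le> (1 + (b - 1)) ^ n"
    using b by (intro Bernoulli_inequality) auto
  moreover have "real n * (1 - b) \<le> 1 / 2" using n1 b by (simp add: field_simps)
  ultimately have bn: "1 / 2 \<le> b ^ n" by (simp add: algebra_simps)
  have "(1 - b) powr (-s) = 2 powr s * (1 / (2 * (1 - b))) powr s"
    unfolding powr_divide powr_mult powr_minus using b by (simp add: field_simps)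
  also have "\<dots> \<le> 2 powr s * real (n + 1) powr s"
    using n2 p s by (intro mult_left_mono powr_mono2) auto
  also have "\<dots> = 2 * 2 powr s * (real (n + 1) powr s * (1 / 2))" by simp
  also have "\<dots> \<le> 2 * 2 powr s * (real (n + 1) powr s * b ^ n)"
    using bn by (intro mult_left_mono) auto
  finally show ?thesis .
qed

section \<open>Coefficient bounds and remainders of dilation\<close>

lemma power_in_bloch: "(\<lambda>z. z ^ m) \<in> bloch_space \<alpha>" if \<alpha>: "0 \<le> \<alpha>"
proof -
  have d: "deriv (\<lambda>z::complex. z ^ m) z = of_nat m * z ^ (m - 1)" for z
    by (rule DERIV_imp_deriv) (auto intro!: derivative_eq_intros)
  have "wt \<alpha> z * cmod (deriv (\<lambda>z. z ^ m) z) \<le> 1 * (real m * 1)" if z: "z \<in> disc" for z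
  proof (rule mult_mono)
    show "wt \<alpha> z \<le> 1" using z \<alpha> by (intro powr_le1) (auto simp: in_disc abs_square_le_1)
    show "cmod (deriv (\<lambda>z. z ^ m) z) \<le> real m * 1"
      using z unfolding d norm_mult norm_power norm_of_nat
      by (intro mult_left_mono power_le_one) (auto simp: in_disc)
  qed auto
  moreover have "(\<lambda>z. z ^ m) holomorphic_on disc" by (intro holomorphic_intros)
  ultimately show ?thesis by (auto simp: bloch_space_def intro!: bdd_aboveI2)
qed

text \<open>The images of 1, z and z^2 have second derivatives A0, A0 phi + A1 and A0 phi^2 + 2 A1
  phi + 2 A2. This triangular system is solved from the top, |phi| \<le> 1 keeping the subtracted
  terms bounded.\<close>

lemma wcomp_coefficients_bounded:
  assumes \<alpha>: "0 \<le> \<alpha>"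
    and u: "u holomorphic_on disc" and p: "\<phi> holomorphic_on disc" and pd: "\<phi> ` disc \<subseteq> disc"
    and T: "\<And>f. f \<in> bloch_space \<alpha> \<Longrightarrow> wcomp u \<phi> f \<in> zygmund_space \<beta>"
  obtains B where "0 \<le> B"
    "\<And>z. z \<in> disc \<Longrightarrow> wt \<beta> z * cmod (deriv (deriv u) z) \<le> B"
    "\<And>z. z \<in> disc \<Longrightarrow> wt \<beta> z * cmod (2 * deriv u z * deriv \<phi> z + u z * deriv (deriv \<phi>) z) \<le> B"
    "\<And>z. z \<in> disc \<Longrightarrow> wt \<beta> z * cmod (u z * (deriv \<phi> z)^2) \<le> B"
proof -
  define N where "N = (\<lambda>m. zygmund_norm \<beta> (wcomp u \<phi> (\<lambda>z. z ^ m)))"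
  define A0 where "A0 = deriv (deriv u)"
  define A1 where "A1 = (\<lambda>z. 2 * deriv u z * deriv \<phi> z + u z * deriv (deriv \<phi>) z)"
  define A2 where "A2 = (\<lambda>z. u z * (deriv \<phi> z)^2)"
  have le: "wt \<beta> z * cmod (A0 z * \<phi> z ^ m + A1 z * (of_nat m * \<phi> z ^ (m - 1))
          + A2 z * (of_nat m * (of_nat (m - 1) * \<phi> z ^ (m - 2)))) \<le> N m" if z: "z \<in> disc" for z m
  proof -
    have hol: "(\<lambda>z. z ^ m) holomorphic_on disc" by (intro holomorphic_intros)
    have d1: "deriv (\<lambda>z::complex. z ^ m) = (\<lambda>z. of_nat m * z ^ (m - 1))"
      by (intro ext DERIV_imp_deriv) (auto intro!: derivative_eq_intros)
    have d2: "deriv (\<lambda>z::complex. of_nat m * z ^ (m - 1)) = (\<lambda>z. of_nat m * (of_nat (m - 1) * z ^ (m - 2)))"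
      by (intro ext DERIV_imp_deriv) (auto intro!: derivative_eq_intros simp: numeral_2_eq_2)
    show ?thesis
      using zygmund_weight_le[OF T[OF power_in_bloch[OF \<alpha>]] z, of m]
      unfolding wcomp_deriv(2)[OF u p pd hol z] d1 d2 N_def
      by (simp add: A0_def A1_def A2_def algebra_simps)
  qed
  define B where "B = N 0 + (N 1 + N 0) + (N 2 + N 0 + 2 * (N 1 + N 0))"
  have b: "wt \<beta> z * cmod (A0 z) \<le> N 0" "wt \<beta> z * cmod (A1 z) \<le> N 1 + N 0"
    "wt \<beta> z * cmod (A2 z) \<le> N 2 + N 0 + 2 * (N 1 + N 0)" if z: "z \<in> disc" for z
  proof -
    have "\<phi> z \<in> disc" using pd z by blast
    then have pz: "cmod (\<phi> z) \<le> 1" by (simp add: in_disc)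
    have shrink: "wt \<beta> z * cmod (x * y) \<le> wt \<beta> z * cmod x" if "cmod y \<le> 1" for x y
      using that by (intro mult_left_mono) (auto simp: norm_mult mult_left_le)
    show 0: "wt \<beta> z * cmod (A0 z) \<le> N 0" using le[OF z, of 0] by simp
    have "wt \<beta> z * cmod (A1 z) \<le> wt \<beta> z * (cmod (A0 z * \<phi> z + A1 z) + cmod (A0 z * \<phi> z))"
      using norm_triangle_ineq4[of "A0 z * \<phi> z + A1 z" "A0 z * \<phi> z"]
      by (intro mult_left_mono) auto
    then show 1: "wt \<beta> z * cmod (A1 z) \<le> N 1 + N 0"
      using le[OF z, of 1] 0 shrink[OF pz, of "A0 z"] unfolding distrib_left by simp
    have pz2: "cmod ((\<phi> z)^2) \<le> 1" using pz by (simp add: norm_power power_le_one)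
    have "cmod (2 * A2 z) \<le> cmod (A0 z * (\<phi> z)^2 + A1 z * (2 * \<phi> z) + A2 z * 2)
        + cmod (A0 z * (\<phi> z)^2) + cmod (A1 z * (2 * \<phi> z))"
      using norm_diff3_le[of "A0 z * (\<phi> z)^2 + A1 z * (2 * \<phi> z) + A2 z * 2" "A0 z * (\<phi> z)^2" "A1 z * (2 * \<phi> z)"]
      by (simp add: mult.commute)
    also have "cmod (A1 z * (2 * \<phi> z)) = 2 * cmod (A1 z * \<phi> z)"
      by (simp add: norm_mult)
    finally have "2 * cmod (A2 z) \<le> cmod (A0 z * (\<phi> z)^2 + A1 z * (2 * \<phi> z) + A2 z * 2)
        + cmod (A0 z * (\<phi> z)^2) + 2 * cmod (A1 z * \<phi> z)" by (simp add: norm_mult)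
    then have "wt \<beta> z * (2 * cmod (A2 z)) \<le> wt \<beta> z * (cmod (A0 z * (\<phi> z)^2 + A1 z * (2 * \<phi> z) + A2 z * 2)
        + cmod (A0 z * (\<phi> z)^2) + 2 * cmod (A1 z * \<phi> z))"
      by (rule mult_left_mono) simp
    moreover have "wt \<beta> z * cmod (A0 z * (\<phi> z)^2 + A1 z * (2 * \<phi> z) + A2 z * 2) \<le> N 2"
      using le[OF z, of 2] by simp
    moreover have "0 \<le> wt \<beta> z * cmod (A2 z)" by simp
    ultimately show "wt \<beta> z * cmod (A2 z) \<le> N 2 + N 0 + 2 * (N 1 + N 0)"
      using 0 1 shrink[OF pz2, of "A0 z"] shrink[OF pz, of "A1 z"]
      by (simp only: distrib_left mult.left_commute[of _ 2])
  qed
  have "0 \<le> N 0" "0 \<le> N 1 + N 0" "0 \<le> N 2 + N 0 + 2 * (N 1 + N 0)"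
    using b[OF zero_in_disc] by (auto intro: order_trans[rotated])
  then have "0 \<le> B" and "wt \<beta> z * cmod (A0 z) \<le> B \<and> wt \<beta> z * cmod (A1 z) \<le> B \<and> wt \<beta> z * cmod (A2 z) \<le> B"
    if "z \<in> disc" for z
    using b[OF that] unfolding B_def by linarith+
  then show ?thesis using that[of B] zero_in_disc unfolding A0_def A1_def A2_def by blast
qed

text \<open>Two families of bounds for two regions. Those with \<open>H\<close> have the sharp
  exponents and do not depend on r; they come from the growth of f and of its dilate and serve where
  |phi| is near 1. Those with \<open>G\<close> gain the factor 1 - r at the price of the exponent
  \<alpha>+2, reached from \<alpha> by two differentiations, and serve elsewhere.\<close>

lemma bloch_dilate_remainder:
  assumes \<alpha>: "1 < \<alpha>" and f: "f \<in> bloch_space \<alpha>" "bloch_norm \<alpha> f \<le> 1"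
    and r: "0 \<le> r" "r \<le> 1" and h_def: "h = (\<lambda>w. f w - f (of_real r * w))" and w: "w \<in> disc"
  defines "H \<equiv> 2 * (1 + 1 / (\<alpha> - 1)) * 2 powr \<alpha> * 2 powr (\<alpha> + 1)"
    and "G \<equiv> 2 powr (\<alpha> + 1) * 2 powr (\<alpha> + 2)"
  shows "h holomorphic_on disc"
    and "cmod (h w) \<le> H * (1 - cmod w) powr (-(\<alpha> - 1))"
    and "cmod (deriv h w) \<le> H * (1 - cmod w) powr (-\<alpha>)"
    and "cmod (deriv (deriv h) w) \<le> H * (1 - cmod w) powr (-(\<alpha> + 1))"
    and "cmod (h w) \<le> (1 - r) * G * (1 - cmod w) powr (-(\<alpha> + 2))"
    and "cmod (deriv h w) \<le> (1 - r) * G * (1 - cmod w) powr (-(\<alpha> + 2))"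
    and "cmod (deriv (deriv h) w) \<le> (1 - r) * G * (1 - cmod w) powr (-(\<alpha> + 2))"
proof -
  have rw: "of_real r * w \<in> disc" "r * cmod w \<le> cmod w" if "w \<in> disc" for w
  proof -
    show 1: "r * cmod w \<le> cmod w" using r by (simp add: mult_left_le_one_le)
    then show "of_real r * w \<in> disc" using that r by (simp add: in_disc norm_mult)
  qed
  have "(\<lambda>w. f (of_real r * w)) holomorphic_on disc"
    using holomorphic_on_compose_gen[of "\<lambda>w. of_real r * w" disc f disc] rw(1)
      bloch_holomorphic[OF f(1)] by (auto simp: o_def intro!: holomorphic_intros)
  then show hol: "h holomorphic_on disc"
    unfolding h_def using bloch_holomorphic[OF f(1)] by (intro holomorphic_on_diff)
  have dhol: "deriv h holomorphic_on disc" using hol by (rule deriv_holomorphic_disc)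
  define D where "D = 1 + 1 / (\<alpha> - 1)"
  have D: "0 < D" using \<alpha> by (simp add: D_def add_pos_pos)
  have h0: "cmod (h w) \<le> (2 * D) * (1 - cmod w) powr (-(\<alpha> - 1))" if w: "w \<in> disc" for w
  proof -
    have "(1 - cmod (of_real r * w)) powr (-(\<alpha> - 1)) \<le> (1 - cmod w) powr (-(\<alpha> - 1))"
      using rw(2)[OF w] w \<alpha> r by (intro powr_mono2') (auto simp: norm_mult in_disc)
    then have "D * (1 - cmod (of_real r * w)) powr (-(\<alpha> - 1)) \<le> D * (1 - cmod w) powr (-(\<alpha> - 1))"
      using D by simp
    then show ?thesis
      using bloch_growth[OF f \<alpha> w] bloch_growth[OF f \<alpha> rw(1)[OF w]]
        norm_triangle_ineq4[of "f w" "f (of_real r * w)"]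
      unfolding h_def D_def[symmetric] by simp
  qed
  have h1: "cmod (deriv h w) \<le> (2 * D * 2 powr \<alpha>) * (1 - cmod w) powr (-\<alpha>)" if w: "w \<in> disc" for w
    using deriv_growth[OF hol _ w h0] \<alpha> by simp
  have h2: "cmod (deriv (deriv h) w) \<le> (2 * D * 2 powr \<alpha> * 2 powr (\<alpha> + 1)) * (1 - cmod w) powr (-(\<alpha> + 1))"
    using deriv_growth[OF dhol _ w h1] \<alpha> by simp
  have k0: "cmod (h w) \<le> (1 - r) * (1 - cmod w) powr (-\<alpha>)" if w: "w \<in> disc" for w
    using bloch_dilate_diff[OF f _ w r] \<alpha> by (simp add: h_def)
  have k1: "cmod (deriv h w) \<le> ((1 - r) * 2 powr (\<alpha> + 1)) * (1 - cmod w) powr (-(\<alpha> + 1))"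
    if w: "w \<in> disc" for w
    using deriv_growth[OF hol _ w k0] \<alpha> by simp
  have k2: "cmod (deriv (deriv h) w) \<le> ((1 - r) * 2 powr (\<alpha> + 1) * 2 powr (\<alpha> + 1 + 1)) * (1 - cmod w) powr (-(\<alpha> + 1 + 1))"
    using deriv_growth[OF dhol _ w k1] \<alpha> by simp
  have one: "1 \<le> (2::real) powr \<alpha>" "1 \<le> (2::real) powr (\<alpha> + 1)" "1 \<le> (2::real) powr (\<alpha> + 2)"
    using \<alpha> by (auto intro!: ge_one_powr_ge_zero)
  have H: "2 * D \<le> H" "2 * D * 2 powr \<alpha> \<le> H" "2 * D * 2 powr \<alpha> * 2 powr (\<alpha> + 1) = H"
  proof -
    have "2 * D * 1 \<le> 2 * D * 2 powr \<alpha>" using one D by (intro mult_left_mono) auto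
    moreover have "2 * D * 2 powr \<alpha> * 1 \<le> 2 * D * 2 powr \<alpha> * 2 powr (\<alpha> + 1)"
      using one D by (intro mult_left_mono) auto
    moreover show "2 * D * 2 powr \<alpha> * 2 powr (\<alpha> + 1) = H" by (simp add: H_def D_def)
    ultimately show "2 * D \<le> H" "2 * D * 2 powr \<alpha> \<le> H" by linarith+
  qed
  show "cmod (h w) \<le> H * (1 - cmod w) powr (-(\<alpha> - 1))"
    using h0[OF w] H(1) by (meson mult_right_mono order_trans powr_ge_zero)
  show "cmod (deriv h w) \<le> H * (1 - cmod w) powr (-\<alpha>)"
    using h1[OF w] H(2) by (meson mult_right_mono order_trans powr_ge_zero)
  show "cmod (deriv (deriv h) w) \<le> H * (1 - cmod w) powr (-(\<alpha> + 1))"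
    using h2 H(3) by simp
  \<comment> \<open>As 0 < 1 - |w| \<le> 1, the smaller exponents can be weakened to \<alpha>+2, so
    one constant suffices later.\<close>
  have mon: "(1 - cmod w) powr (-s) \<le> (1 - cmod w) powr (-(\<alpha> + 2))" if "s \<le> \<alpha> + 2" for s
    using w that by (intro powr_mono') (auto simp: in_disc)
  have "(1 - r) * 1 \<le> (1 - r) * G"
    unfolding G_def using r mult_mono[OF one(2,3)] by (intro mult_left_mono) auto
  then show "cmod (h w) \<le> (1 - r) * G * (1 - cmod w) powr (-(\<alpha> + 2))"
    using k0[OF w] mult_mono[of "1 - r" "(1 - r) * G", OF _ mon[of \<alpha>]] r by (simp add: G_def)
  have "(1 - r) * 2 powr (\<alpha> + 1) * 1 \<le> (1 - r) * 2 powr (\<alpha> + 1) * 2 powr (\<alpha> + 2)"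
    using r one by (intro mult_left_mono) auto
  then have "(1 - r) * 2 powr (\<alpha> + 1) \<le> (1 - r) * G" by (simp add: G_def mult.assoc)
  then show "cmod (deriv h w) \<le> (1 - r) * G * (1 - cmod w) powr (-(\<alpha> + 2))"
    using k1[OF w] mult_mono[of "(1 - r) * 2 powr (\<alpha> + 1)" "(1 - r) * G", OF _ mon[of "\<alpha> + 1"]] r
    by (simp add: G_def)
  show "cmod (deriv (deriv h) w) \<le> (1 - r) * G * (1 - cmod w) powr (-(\<alpha> + 2))"
    using k2 by (simp add: G_def mult.assoc add.assoc)
qed

text \<open>Replacing phi by r phi multiplies A1 by r and A2 by r^2 and leaves A0 alone, so the same
  bound \<open>B\<close> serves.\<close>

lemma compact_op_dilated_wcomp:
  assumes \<alpha>: "1 < \<alpha>" and r: "0 \<le> r" "r < 1"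
    and u: "u holomorphic_on disc" and p: "\<phi> holomorphic_on disc" and pd: "\<phi> ` disc \<subseteq> disc"
    and B: "\<And>z. z \<in> disc \<Longrightarrow> wt \<beta> z * cmod (deriv (deriv u) z) \<le> B"
      "\<And>z. z \<in> disc \<Longrightarrow> wt \<beta> z * cmod (2 * deriv u z * deriv \<phi> z + u z * deriv (deriv \<phi>) z) \<le> B"
      "\<And>z. z \<in> disc \<Longrightarrow> wt \<beta> z * cmod (u z * (deriv \<phi> z)^2) \<le> B"
  shows "compact_op (bloch_space \<alpha>) (bloch_norm \<alpha>) (zygmund_space \<beta>) (zygmund_norm \<beta>)
    (wcomp u (\<lambda>z. of_real r * \<phi> z))"
proof (rule compact_op_wcomp[OF \<alpha> u _ r(2), where B = B])
  let ?\<psi> = "\<lambda>z. of_real r * \<phi> z"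
  show "?\<psi> holomorphic_on disc" using p by (intro holomorphic_intros)
  have d1: "deriv ?\<psi> z = of_real r * deriv \<phi> z" if "z \<in> disc" for z
    by (rule DERIV_imp_deriv) (intro DERIV_cmult deriv_has_field_derivative p that)
  have d2: "deriv (deriv ?\<psi>) z = of_real r * deriv (deriv \<phi>) z" if z: "z \<in> disc" for z
  proof -
    have "deriv (deriv ?\<psi>) z = deriv (\<lambda>z. of_real r * deriv \<phi> z) z"
      using d1 z by (rule deriv_cong_disc)
    also have "\<dots> = of_real r * deriv (deriv \<phi>) z"
      by (rule DERIV_imp_deriv)
        (intro DERIV_cmult deriv_has_field_derivative deriv_holomorphic_disc p z)
    finally show ?thesis .
  qed
  have shrink: "wt \<beta> z * cmod (of_real s * x) \<le> B"
    if "wt \<beta> z * cmod x \<le> B" "0 \<le> s" "s \<le> 1" for s x z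
  proof -
    have "wt \<beta> z * cmod (of_real s * x) \<le> wt \<beta> z * cmod x"
      using that by (intro mult_left_mono) (auto simp: norm_mult mult_left_le_one_le)
    then show ?thesis using that by linarith
  qed
  fix z assume z: "z \<in> disc"
  have "\<phi> z \<in> disc" using pd z by blast
  then show "cmod (?\<psi> z) \<le> r" using r by (simp add: norm_mult in_disc mult_left_le)
  show "wt \<beta> z * cmod (deriv (deriv u) z) \<le> B" by (rule B(1)[OF z])
  have "2 * deriv u z * deriv ?\<psi> z + u z * deriv (deriv ?\<psi>) z
      = of_real r * (2 * deriv u z * deriv \<phi> z + u z * deriv (deriv \<phi>) z)"
    by (simp add: d1[OF z] d2[OF z] algebra_simps)
  then show "wt \<beta> z * cmod (2 * deriv u z * deriv ?\<psi> z + u z * deriv (deriv ?\<psi>) z) \<le> B"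
    using shrink[OF B(2)[OF z], of r] r by simp
  have eq: "u z * (deriv ?\<psi> z)^2 = of_real (r^2) * (u z * (deriv \<phi> z)^2)"
    by (simp add: d1[OF z] power_mult_distrib)
  show "wt \<beta> z * cmod (u z * (deriv ?\<psi> z)^2) \<le> B"
    unfolding eq by (rule shrink[OF B(3)[OF z]]) (use r in \<open>auto simp: power_le_one\<close>)
qed

section \<open>The upper bound\<close>

text \<open>Eventual bounds by a positive e replace the upper limits, which makes room for an error
  of size e even when the upper limits vanish. One compact operator of dilation type, chosen for
  this e, suffices to bound the infimum.\<close>

lemma essential_norm_upper:
  assumes \<alpha>: "1 < \<alpha>"
  obtains C :: real where "0 < C"
    "\<And>\<beta> u \<phi> e. \<lbrakk>u holomorphic_on disc; \<phi> holomorphic_on disc; \<phi> ` disc \<subseteq> disc;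
      bounded_op (bloch_space \<alpha>) (bloch_norm \<alpha>) (zygmund_space \<beta>) (zygmund_norm \<beta>) (wcomp u \<phi>);
      0 < e;
      eventually (\<lambda>n. ereal (real (n+1) powr \<alpha>) *
        nu_norm \<beta> (\<lambda>z. (2 * deriv u z * deriv \<phi> z + u z * deriv (deriv \<phi>) z) * (\<phi> z)^n) \<le> ereal e) sequentially;
      eventually (\<lambda>n. ereal (real (n+1) powr (\<alpha>+1)) *
        nu_norm \<beta> (\<lambda>z. u z * (deriv \<phi> z)^2 * (\<phi> z)^n) \<le> ereal e) sequentially;
      eventually (\<lambda>n. ereal (real (n+1) powr (\<alpha>-1)) *
        nu_norm \<beta> (\<lambda>z. deriv (deriv u) z * (\<phi> z)^n) \<le> ereal e) sequentially\<rbrakk> \<Longrightarrow>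
      essential_norm (bloch_space \<alpha>) (bloch_norm \<alpha>) (zygmund_space \<beta>) (zygmund_norm \<beta>) (wcomp u \<phi>) \<le> C * e"
proof -
  define H where "H = 2 * (1 + 1 / (\<alpha> - 1)) * 2 powr \<alpha> * 2 powr (\<alpha> + 1)"
  \<comment> \<open>The constant for comparing powers at the largest exponent, s = \<alpha>+1; it
    covers the two smaller ones.\<close>
  define J where "J = 2 * 2 powr (\<alpha> + 1)"
  have H: "0 \<le> H" using \<alpha> by (simp add: H_def)
  have J: "0 \<le> J" by (simp add: J_def)
  \<comment> \<open>Near the boundary each of the three coefficient terms costs H J e; all that
    carries the factor 1 - r is made at most e and fits into the 2.\<close>
  define C where "C = 2 + 3 * H * J"
  have C: "0 < C" using H J by (simp add: C_def add_pos_nonneg)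
  show ?thesis
  proof (rule that[OF C])
    fix \<beta> u \<phi> and e :: real
    assume u: "u holomorphic_on disc" and p: "\<phi> holomorphic_on disc" and pd: "\<phi> ` disc \<subseteq> disc"
      and T: "bounded_op (bloch_space \<alpha>) (bloch_norm \<alpha>) (zygmund_space \<beta>) (zygmund_norm \<beta>) (wcomp u \<phi>)"
      and e: "0 < e"
      and ev1: "eventually (\<lambda>n. ereal (real (n+1) powr \<alpha>) *
        nu_norm \<beta> (\<lambda>z. (2 * deriv u z * deriv \<phi> z + u z * deriv (deriv \<phi>) z) * (\<phi> z)^n) \<le> ereal e) sequentially"
      and ev2: "eventually (\<lambda>n. ereal (real (n+1) powr (\<alpha>+1)) *
        nu_norm \<beta> (\<lambda>z. u z * (deriv \<phi> z)^2 * (\<phi> z)^n) \<le> ereal e) sequentially"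
      and ev0: "eventually (\<lambda>n. ereal (real (n+1) powr (\<alpha>-1)) *
        nu_norm \<beta> (\<lambda>z. deriv (deriv u) z * (\<phi> z)^n) \<le> ereal e) sequentially"
    let ?X = "bloch_space \<alpha>" and ?nX = "bloch_norm \<alpha>" and ?Y = "zygmund_space \<beta>" and ?nY = "zygmund_norm \<beta>"
    define A0 where "A0 = deriv (deriv u)"
    define A1 where "A1 = (\<lambda>z. 2 * deriv u z * deriv \<phi> z + u z * deriv (deriv \<phi>) z)"
    define A2 where "A2 = (\<lambda>z. u z * (deriv \<phi> z)^2)"
    have TY: "wcomp u \<phi> f \<in> ?Y" if "f \<in> ?X" for f
      using T that by (simp add: bounded_op_def linear_op_def)
    obtain B where B0: "0 \<le> B"
      and B: "\<And>z. z \<in> disc \<Longrightarrow> wt \<beta> z * cmod (deriv (deriv u) z) \<le> B"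
        "\<And>z. z \<in> disc \<Longrightarrow> wt \<beta> z * cmod (2 * deriv u z * deriv \<phi> z + u z * deriv (deriv \<phi>) z) \<le> B"
        "\<And>z. z \<in> disc \<Longrightarrow> wt \<beta> z * cmod (u z * (deriv \<phi> z)^2) \<le> B"
    proof (rule wcomp_coefficients_bounded[OF _ u p pd TY])
      show "0 \<le> \<alpha>" using \<alpha> by simp
    qed (assumption | rule that)+
    obtain n0 where n0: "\<And>n. n0 \<le> n \<Longrightarrow>
        ereal (real (n+1) powr (\<alpha>-1)) * nu_norm \<beta> (\<lambda>z. A0 z * (\<phi> z)^n) \<le> ereal e \<and>
        ereal (real (n+1) powr \<alpha>) * nu_norm \<beta> (\<lambda>z. A1 z * (\<phi> z)^n) \<le> ereal e \<and>
        ereal (real (n+1) powr (\<alpha>+1)) * nu_norm \<beta> (\<lambda>z. A2 z * (\<phi> z)^n) \<le> ereal e"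
      using eventually_conj[OF ev0 eventually_conj[OF ev1 ev2]]
      unfolding A0_def A1_def A2_def eventually_sequentially by blast
    have phi: "\<phi> z \<in> disc" "cmod (\<phi> z) < 1" if "z \<in> disc" for z
      using pd that by (auto simp: in_disc[symmetric])
    \<comment> \<open>Beyond the second entry, the integer n attached to |phi z| is at least
      \<open>n0\<close>, so the assumed bounds hold for it. The first entry puts the point 0 into
      the other region, where the initial values in the Zygmund norm can be made small.\<close>
    define \<rho> where "\<rho> = max (cmod (\<phi> 0)) (1 - 1 / (2 * (real n0 + 1)))"
    have \<rho>: "0 \<le> \<rho>" "\<rho> < 1" "cmod (\<phi> 0) \<le> \<rho>"
      using phi[of 0] by (auto simp: \<rho>_def le_max_iff_disj)
    have near: "wt \<beta> z * cmod (A0 z) * (1 - cmod (\<phi> z)) powr (-(\<alpha> - 1)) \<le> J * e \<and>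
        wt \<beta> z * cmod (A1 z) * (1 - cmod (\<phi> z)) powr (-\<alpha>) \<le> J * e \<and>
        wt \<beta> z * cmod (A2 z) * (1 - cmod (\<phi> z)) powr (-(\<alpha> + 1)) \<le> J * e"
      if z: "z \<in> disc" and b: "\<rho> < cmod (\<phi> z)" for z
    proof -
      define n where "n = nat \<lfloor>1 / (2 * (1 - cmod (\<phi> z)))\<rfloor>"
      have "1 - 1 / (2 * (real n0 + 1)) < cmod (\<phi> z)" using b by (simp add: \<rho>_def)
      then have "real n0 + 1 \<le> 1 / (2 * (1 - cmod (\<phi> z)))"
        using phi(2)[OF z] by (simp add: field_simps)
      then have n: "n0 \<le> n" unfolding n_def by linarith
      have gen: "wt \<beta> z * cmod (A z) * (1 - cmod (\<phi> z)) powr (-s) \<le> J * e"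
        if s: "0 \<le> s" "s \<le> \<alpha> + 1"
          and A: "ereal (real (n+1) powr s) * nu_norm \<beta> (\<lambda>z. A z * (\<phi> z)^n) \<le> ereal e" for s A
      proof -
        have "wt \<beta> z * cmod (A z) * (1 - cmod (\<phi> z)) powr (-s)
            \<le> wt \<beta> z * cmod (A z) * (2 * 2 powr s * (real (n + 1) powr s * cmod (\<phi> z) ^ n))"
          unfolding n_def using phi(2)[OF z] s by (intro mult_left_mono powr_le_power) auto
        also have "\<dots> = 2 * 2 powr s * (real (n + 1) powr s * (wt \<beta> z * cmod (A z * (\<phi> z)^n)))"
          by (simp add: norm_mult norm_power)
        also have "\<dots> \<le> 2 * 2 powr s * e"
          using nu_norm_mult_leD[OF _ A z] by (intro mult_left_mono) auto
        also have "\<dots> \<le> J * e"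
          using s e unfolding J_def by (intro mult_right_mono mult_left_mono powr_mono) auto
        finally show ?thesis .
      qed
      show ?thesis using n0[OF n] \<alpha> by (intro conjI gen) auto
    qed
    define G where "G = 2 powr (\<alpha> + 1) * 2 powr (\<alpha> + 2) * (1 - \<rho>) powr (-(\<alpha> + 2))"
    have G: "0 \<le> G" by (simp add: G_def)
    define Q where "Q = (cmod (u 0) + cmod (deriv u 0) + cmod (u 0) * cmod (deriv \<phi> 0) + 3 * B) * G"
    have Q: "0 \<le> Q" using G B0 by (simp add: Q_def)
    \<comment> \<open>\<open>Q\<close> collects every coefficient multiplied by 1 - r. It is fixed
      before r, so 1 - r can be chosen against it; the minimum with 1 keeps r nonnegative.\<close>
    define r where "r = 1 - min 1 (e / (Q + 1))"
    have e1: "0 < e / (Q + 1)" using e Q by simp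
    have r: "0 \<le> r" "r < 1" using e1 by (auto simp: r_def)
    have "(1 - r) * Q \<le> e / (Q + 1) * Q" using Q by (intro mult_right_mono) (auto simp: r_def)
    also have "\<dots> \<le> e" using e Q by (simp add: field_simps)
    finally have rQ: "(1 - r) * Q \<le> e" .
    define K where "K = wcomp u (\<lambda>z. of_real r * \<phi> z)"
    have comp: "compact_op ?X ?nX ?Y ?nY K"
      unfolding K_def by (rule compact_op_dilated_wcomp[OF \<alpha> r u p pd B])
    have bound: "?nY (\<lambda>z. wcomp u \<phi> f z - K f z) \<le> C * e" if f: "f \<in> ?X" "?nX f \<le> 1" for f
    proof -
      define h where "h = (\<lambda>w. f w - f (of_real r * w))"
      have eq: "(\<lambda>z. wcomp u \<phi> f z - K f z) = wcomp u \<phi> h"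
        by (simp add: K_def wcomp_def h_def algebra_simps)
      note rem = bloch_dilate_remainder[OF \<alpha> f r(1) less_imp_le[OF r(2)] h_def, folded H_def]
      have hol: "h holomorphic_on disc" by (rule rem(1)[OF zero_in_disc])
      have far: "cmod (h (\<phi> z)) \<le> (1 - r) * G" "cmod (deriv h (\<phi> z)) \<le> (1 - r) * G"
        "cmod (deriv (deriv h) (\<phi> z)) \<le> (1 - r) * G" if z: "z \<in> disc" and b: "cmod (\<phi> z) \<le> \<rho>" for z
      proof -
        have "(1 - cmod (\<phi> z)) powr (-(\<alpha> + 2)) \<le> (1 - \<rho>) powr (-(\<alpha> + 2))"
          using b \<rho> \<alpha> by (intro powr_mono2') auto
        then have "(1 - r) * (2 powr (\<alpha> + 1) * 2 powr (\<alpha> + 2)) * (1 - cmod (\<phi> z)) powr (-(\<alpha> + 2))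
            \<le> (1 - r) * (2 powr (\<alpha> + 1) * 2 powr (\<alpha> + 2)) * (1 - \<rho>) powr (-(\<alpha> + 2))"
          using r by (intro mult_left_mono) auto
        also have "\<dots> = (1 - r) * G" by (simp add: G_def mult.assoc)
        finally have *: "(1 - r) * (2 powr (\<alpha> + 1) * 2 powr (\<alpha> + 2)) * (1 - cmod (\<phi> z)) powr (-(\<alpha> + 2))
            \<le> (1 - r) * G" .
        show "cmod (h (\<phi> z)) \<le> (1 - r) * G" "cmod (deriv h (\<phi> z)) \<le> (1 - r) * G"
          "cmod (deriv (deriv h) (\<phi> z)) \<le> (1 - r) * G"
          using rem(5-7)[OF phi(1)[OF z]] * by (auto intro: order_trans)
      qed
      have S: "wt \<beta> z * (cmod (deriv (deriv u) z) * cmod (h (\<phi> z))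
        + cmod (2 * deriv u z * deriv \<phi> z + u z * deriv (deriv \<phi>) z) * cmod (deriv h (\<phi> z))
        + cmod (u z * (deriv \<phi> z)^2) * cmod (deriv (deriv h) (\<phi> z))) \<le> 3 * B * ((1 - r) * G) + 3 * H * (J * e)"
        if z: "z \<in> disc" for z
      proof -
        have eq: "wt \<beta> z * (cmod (deriv (deriv u) z) * cmod (h (\<phi> z))
          + cmod (2 * deriv u z * deriv \<phi> z + u z * deriv (deriv \<phi>) z) * cmod (deriv h (\<phi> z))
          + cmod (u z * (deriv \<phi> z)^2) * cmod (deriv (deriv h) (\<phi> z)))
          = (wt \<beta> z * cmod (A0 z)) * cmod (h (\<phi> z)) + (wt \<beta> z * cmod (A1 z)) * cmod (deriv h (\<phi> z))
            + (wt \<beta> z * cmod (A2 z)) * cmod (deriv (deriv h) (\<phi> z))"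
          by (simp add: A0_def A1_def A2_def distrib_left mult.assoc)
        have rG: "0 \<le> (1 - r) * G" using r G by simp
        show ?thesis
        proof (cases "cmod (\<phi> z) \<le> \<rho>")
          case True
          have "(wt \<beta> z * cmod (A0 z)) * cmod (h (\<phi> z)) + (wt \<beta> z * cmod (A1 z)) * cmod (deriv h (\<phi> z))
            + (wt \<beta> z * cmod (A2 z)) * cmod (deriv (deriv h) (\<phi> z))
            \<le> B * ((1 - r) * G) + B * ((1 - r) * G) + B * ((1 - r) * G)"
            unfolding A0_def A1_def A2_def
            by (intro add_mono mult_mono B[OF z] far[OF z True] B0 norm_ge_zero)
          moreover have "0 \<le> 3 * H * (J * e)" using H J e by simp
          ultimately show ?thesis unfolding eq by (simp add: algebra_simps)
        next
          case False
          \<comment> \<open>Here x is a weighted coefficient, y a value or derivative of h, and q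
            the power of 1 - |phi z| at which the growth of y and the decay of x match.\<close>
          have gen: "x * y \<le> H * (J * e)" if "0 \<le> x" "y \<le> H * q" "x * q \<le> J * e" for x y q :: real
          proof -
            have "x * y \<le> x * (H * q)" using that by (intro mult_left_mono)
            also have "\<dots> = H * (x * q)" by simp
            also have "\<dots> \<le> H * (J * e)" using that H by (intro mult_left_mono)
            finally show ?thesis .
          qed
          have nr: "wt \<beta> z * cmod (A0 z) * (1 - cmod (\<phi> z)) powr (-(\<alpha> - 1)) \<le> J * e"
            "wt \<beta> z * cmod (A1 z) * (1 - cmod (\<phi> z)) powr (-\<alpha>) \<le> J * e"
            "wt \<beta> z * cmod (A2 z) * (1 - cmod (\<phi> z)) powr (-(\<alpha> + 1)) \<le> J * e"
            using near[OF z] False by auto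
          have "(wt \<beta> z * cmod (A0 z)) * cmod (h (\<phi> z)) + (wt \<beta> z * cmod (A1 z)) * cmod (deriv h (\<phi> z))
            + (wt \<beta> z * cmod (A2 z)) * cmod (deriv (deriv h) (\<phi> z))
            \<le> H * (J * e) + H * (J * e) + H * (J * e)"
            by (intro add_mono gen[OF _ rem(2)[OF phi(1)[OF z]] nr(1)]
              gen[OF _ rem(3)[OF phi(1)[OF z]] nr(2)] gen[OF _ rem(4)[OF phi(1)[OF z]] nr(3)]) auto
          moreover have "0 \<le> 3 * B * ((1 - r) * G)" using B0 rG by simp
          ultimately show ?thesis unfolding eq by (simp add: algebra_simps)
        qed
      qed
      have "?nY (wcomp u \<phi> h) \<le> cmod (u 0) * cmod (h (\<phi> 0)) + cmod (deriv u 0) * cmod (h (\<phi> 0))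
          + cmod (u 0) * cmod (deriv \<phi> 0) * cmod (deriv h (\<phi> 0)) + (3 * B * ((1 - r) * G) + 3 * H * (J * e))"
        by (rule wcomp_zygmund_le(2)[OF u p pd hol S])
      also have "\<dots> \<le> cmod (u 0) * ((1 - r) * G) + cmod (deriv u 0) * ((1 - r) * G)
          + cmod (u 0) * cmod (deriv \<phi> 0) * ((1 - r) * G) + (3 * B * ((1 - r) * G) + 3 * H * (J * e))"
        by (intro add_mono order_refl mult_left_mono far[OF zero_in_disc \<rho>(3)]) auto
      also have "\<dots> = (1 - r) * Q + 3 * H * J * e" by (simp add: Q_def algebra_simps)
      also have "\<dots> \<le> C * e" using rQ e by (simp add: C_def algebra_simps)
      finally show ?thesis unfolding eq .
    qed
    \<comment> \<open>The zero function makes the unit ball nonempty, as the real supremum requires,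
      and later witnesses that operator norms are nonnegative.\<close>
    have zX: "(\<lambda>z. 0) \<in> ?X \<and> ?nX (\<lambda>z. 0) \<le> 0"
      using bloch_normI[of "\<lambda>z. 0" \<alpha> 0] by simp
    have "op_norm ?X ?nX ?nY (\<lambda>f z. wcomp u \<phi> f z - K f z) \<le> C * e"
      unfolding op_norm_def using bound zX by (intro cSUP_least) (auto intro: exI[of _ "\<lambda>z. 0"])
    \<comment> \<open>A real infimum lies below its members only if the set is bounded below; 0 is
      such a bound.\<close>
    moreover have "bdd_below ((\<lambda>K. op_norm ?X ?nX ?nY (\<lambda>f z. wcomp u \<phi> f z - K f z)) ` {K. compact_op ?X ?nX ?Y ?nY K})"
    proof (rule bdd_belowI2)
      fix K assume "K \<in> {K. compact_op ?X ?nX ?Y ?nY K}"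
      then have K: "compact_op ?X ?nX ?Y ?nY K" by simp
      have KY: "K f \<in> ?Y" if "f \<in> ?X" for f
        using K that by (simp add: compact_op_def linear_op_def)
      have "0 \<le> ?nY (\<lambda>z. wcomp u \<phi> (\<lambda>z. 0) z - K (\<lambda>z. 0) z)"
        using zX by (intro zygmund_norm_nonneg zygmund_diff TY KY) auto
      also have "\<dots> \<le> op_norm ?X ?nX ?nY (\<lambda>f z. wcomp u \<phi> f z - K f z)"
        using zX by (intro op_norm_upper[OF T K bloch_norm_nonneg]) auto
      finally show "0 \<le> op_norm ?X ?nX ?nY (\<lambda>f z. wcomp u \<phi> f z - K f z)" .
    qed
    ultimately show "essential_norm ?X ?nX ?Y ?nY (wcomp u \<phi>) \<le> C * e"
      unfolding essential_norm_def using comp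
      by (intro cInf_lower2[where x = "op_norm ?X ?nX ?nY (\<lambda>f z. wcomp u \<phi> f z - K f z)"]) auto
  qed
qed

section \<open>Combination of the two bounds\<close>

lemma nu_norm_nonneg: "0 \<le> nu_norm \<beta> g"
proof -
  have "0 \<le> ereal (wt \<beta> 0 * cmod (g 0))" by simp
  also have "\<dots> \<le> nu_norm \<beta> g" unfolding nu_norm_def by (rule SUP_upper[OF zero_in_disc])
  finally show ?thesis .
qed

theorem theorem4p4:
  fixes \<alpha> \<beta> :: real
  assumes "\<alpha> > 1" and "\<beta> > 0"
  shows "\<exists>C>0. \<forall>u \<phi>. u holomorphic_on disc \<longrightarrow> \<phi> holomorphic_on disc \<longrightarrow> \<phi> ` disc \<subseteq> disc \<longrightarrow>
     bounded_op (bloch_space \<alpha>) (bloch_norm \<alpha>) (zygmund_space \<beta>) (zygmund_norm \<beta>) (wcomp u \<phi>) \<longrightarrow>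
     (let E = max (limsup (\<lambda>n. ereal (real (n+1) powr \<alpha>) *
                     nu_norm \<beta> (\<lambda>z. (2 * deriv u z * deriv \<phi> z + u z * deriv (deriv \<phi>) z) * (\<phi> z)^n)))
              (max (limsup (\<lambda>n. ereal (real (n+1) powr (\<alpha>+1)) *
                     nu_norm \<beta> (\<lambda>z. u z * (deriv \<phi> z)^2 * (\<phi> z)^n)))
                   (limsup (\<lambda>n. ereal (real (n+1) powr (\<alpha>-1)) *
                     nu_norm \<beta> (\<lambda>z. deriv (deriv u) z * (\<phi> z)^n))));
          ess = essential_norm (bloch_space \<alpha>) (bloch_norm \<alpha>) (zygmund_space \<beta>) (zygmund_norm \<beta>) (wcomp u \<phi>)
      in E / ereal C \<le> ereal ess \<and> ereal ess \<le> ereal C * E)"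
proof -
  let ?ess = "\<lambda>u \<phi>. essential_norm (bloch_space \<alpha>) (bloch_norm \<alpha>) (zygmund_space \<beta>) (zygmund_norm \<beta>) (wcomp u \<phi>)"
  let ?s1 = "\<lambda>u \<phi> n. ereal (real (n+1) powr \<alpha>) *
    nu_norm \<beta> (\<lambda>z. (2 * deriv u z * deriv \<phi> z + u z * deriv (deriv \<phi>) z) * (\<phi> z)^n)"
  let ?s2 = "\<lambda>u \<phi> n. ereal (real (n+1) powr (\<alpha>+1)) * nu_norm \<beta> (\<lambda>z. u z * (deriv \<phi> z)^2 * (\<phi> z)^n)"
  let ?s0 = "\<lambda>u \<phi> n. ereal (real (n+1) powr (\<alpha>-1)) * nu_norm \<beta> (\<lambda>z. deriv (deriv u) z * (\<phi> z)^n)"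
  let ?E = "\<lambda>u \<phi>. max (limsup (?s1 u \<phi>)) (max (limsup (?s2 u \<phi>)) (limsup (?s0 u \<phi>)))"
  obtain C1 where C1: "0 < C1" and lower: "\<And>u \<phi> K. \<lbrakk>u holomorphic_on disc; \<phi> holomorphic_on disc; \<phi> ` disc \<subseteq> disc;
      bounded_op (bloch_space \<alpha>) (bloch_norm \<alpha>) (zygmund_space \<beta>) (zygmund_norm \<beta>) (wcomp u \<phi>);
      compact_op (bloch_space \<alpha>) (bloch_norm \<alpha>) (zygmund_space \<beta>) (zygmund_norm \<beta>) K\<rbrakk> \<Longrightarrow>
      ?E u \<phi> \<le> ereal (C1 * op_norm (bloch_space \<alpha>) (bloch_norm \<alpha>) (zygmund_norm \<beta>) (\<lambda>f z. wcomp u \<phi> f z - K f z))"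
    by (rule essential_norm_lower[OF assms(1)]) (rule that; blast)
  obtain C2 where C2: "0 < C2" and upper: "\<And>u \<phi> e. \<lbrakk>u holomorphic_on disc; \<phi> holomorphic_on disc; \<phi> ` disc \<subseteq> disc;
      bounded_op (bloch_space \<alpha>) (bloch_norm \<alpha>) (zygmund_space \<beta>) (zygmund_norm \<beta>) (wcomp u \<phi>);
      0 < e; eventually (\<lambda>n. ?s1 u \<phi> n \<le> ereal e) sequentially;
      eventually (\<lambda>n. ?s2 u \<phi> n \<le> ereal e) sequentially;
      eventually (\<lambda>n. ?s0 u \<phi> n \<le> ereal e) sequentially\<rbrakk> \<Longrightarrow> ?ess u \<phi> \<le> C2 * e"
    by (rule essential_norm_upper[OF assms(1)]) (rule that; blast)
  define C where "C = max C1 C2"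
  have C: "0 < C" "C1 \<le> C" "C2 \<le> C" using C1 by (auto simp: C_def)
  have main: "?E u \<phi> / ereal C \<le> ereal (?ess u \<phi>) \<and> ereal (?ess u \<phi>) \<le> ereal C * ?E u \<phi>"
    if h: "u holomorphic_on disc" "\<phi> holomorphic_on disc" "\<phi> ` disc \<subseteq> disc"
      "bounded_op (bloch_space \<alpha>) (bloch_norm \<alpha>) (zygmund_space \<beta>) (zygmund_norm \<beta>) (wcomp u \<phi>)" for u \<phi>
  proof -
    define E where "E = ?E u \<phi>"
    have "0 \<le> limsup (?s1 u \<phi>)"
      by (intro le_Limsup always_eventually allI ereal_0_le_mult nu_norm_nonneg) auto
    then have E0: "0 \<le> E" by (simp add: E_def le_max_iff_disj)
    \<comment> \<open>The zero operator has two uses: the lower bound at it shows that E is finite,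
      and it makes the set in the infimum nonempty.\<close>
    have "compact_op (bloch_space \<alpha>) (bloch_norm \<alpha>) (zygmund_space \<beta>) (zygmund_norm \<beta>) (wcomp (\<lambda>z. 0) (\<lambda>z. 0))"
      by (rule compact_op_wcomp[OF assms(1), where r = 0 and B = 0]) auto
    note zero = this
    have "E \<noteq> \<infinity>" using lower[OF h zero, folded E_def] by auto
    then obtain e where Ee: "E = ereal e" and e: "0 \<le> e" using E0 by (cases E) auto
    have "e / C \<le> ?ess u \<phi>"
      unfolding essential_norm_def
    proof (rule cInf_greatest)
      fix x assume "x \<in> (\<lambda>K. op_norm (bloch_space \<alpha>) (bloch_norm \<alpha>) (zygmund_norm \<beta>) (\<lambda>f z. wcomp u \<phi> f z - K f z)) `
        {K. compact_op (bloch_space \<alpha>) (bloch_norm \<alpha>) (zygmund_space \<beta>) (zygmund_norm \<beta>) K}"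
      then have "e \<le> C1 * x" using lower[OF h, folded E_def] unfolding Ee by auto
      then have "e / C1 \<le> x" using C1 by (simp add: field_simps)
      moreover have "e / C \<le> e / C1" using C1 C e by (intro divide_left_mono) auto
      ultimately show "e / C \<le> x" by linarith
    qed (use zero in auto)
    moreover have "?ess u \<phi> \<le> C2 * e"
    proof (rule field_le_epsilon)
      fix d :: real assume d: "0 < d"
      \<comment> \<open>Strictly above E, so that upper limits at most E yield eventual bounds, and
        positive even if E = 0; the excess contributes exactly d.\<close>
      define e' where "e' = e + d / C2"
      have e': "0 < e'" "E < ereal e'" using e d C2 by (auto simp: e'_def Ee add_nonneg_pos)
      have ev: "eventually (\<lambda>n. s n \<le> ereal e') sequentially" if "limsup s \<le> E" for s
      proof -
        have "limsup s < ereal e'" using that e'(2) by (rule le_less_trans)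
        then show ?thesis by (auto dest!: Limsup_lessD elim: eventually_mono)
      qed
      have "?ess u \<phi> \<le> C2 * e'"
        by (rule upper[OF h e'(1)]; rule ev) (simp_all add: E_def le_max_iff_disj)
      also have "C2 * e' = C2 * e + d" using C2 by (simp add: e'_def distrib_left)
      finally show "?ess u \<phi> \<le> C2 * e + d" .
    qed
    moreover have "C2 * e \<le> C * e" using C e by (intro mult_right_mono) auto
    ultimately show ?thesis using C unfolding E_def[symmetric] Ee by simp
  qed
  show ?thesis
    unfolding Let_def using C(1) main by blast
qed

end
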